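(* Let $\rho^{AB}=\{\rho_n^{AB}\}_{n\ge1}$ be a sequence of bipartite states on $\mathcal{H}_A^{(n)}\otimes\mathcal{H}_B^{(n)}$ with $\dim\mathcal{H}_A^{(n)}=d^n$, shared between a sender (holding $A$) and a receiver (holding $B$), where the sender may transmit system $A$ through a noiseless channel. The dense coding capacity is \[ C_{DC}=\log d-\inf_{\Lambda}\overline{S}(\Lambda A|B), \] where the infimum is over sequences $\Lambda=\{\Lambda_n^A\}$ of CPTP maps on $\mathcal{B}(\mathcal{H}_A^{(n)})$ and $\overline{S}(\Lambda A|B)$ is the conditional spectral sup-entropy rate of the sequence $\rho_n^{\Lambda AB}:=(\Lambda^A_n\otimes\mathrm{id}^B)\rho_n^{AB}$.
   Context: Logarithms are natural. For self-adjoint $A=\sum_i\lambda_i|i\rangle\langle i|$, $\{A\ge0\}:=\sum_{\lambda_i\ge0}|i\rangle\langle i|$ and $\{A\ge B\}:=\{A-B\ge0\}$. For a sequence of bipartite states $\tau=\{\tau_n^{AB}\}$ with $B$-marginals $\tau_n^B$, the conditional spectral sup-entropy rate is \[ \overline{S}(A|B)=\inf\Big\{\gamma:\ \liminf_{n\to\infty}\mathrm{Tr}\big[\{\tau_n^{AB}\ge e^{-n\gamma}I^A_n\otimes\tau_n^B\}(\tau_n^{AB}-e^{-n\gamma}I^A_n\otimes\tau_n^B)\big]=1\Big\}. \] A dense coding code $\mathcal{C}^{(n)}$ of size $M_n$ consists of CPTP maps $\mathcal{E}^A_{n,i}$ on $\mathcal{B}(\mathcal{H}_A^{(n)})$, $i=1,\dots,M_n$,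 giving codewords $\rho^{AB}_{n,i}=(\mathcal{E}^A_{n,i}\otimes\mathrm{id}^B)\rho_n^{AB}$, and positive operators $E^{AB}_{n,i}$ on $\mathcal{H}_A^{(n)}\otimes\mathcal{H}_B^{(n)}$ with $\sum_iE^{AB}_{n,i}\le I$; its average error probability is $P_e(\mathcal{C}^{(n)})=\frac1{M_n}\sum_{i=1}^{M_n}(1-\mathrm{Tr}(\rho^{AB}_{n,i}E^{AB}_{n,i}))$. A rate $R$ is achievable if there are codes with $M_n\ge e^{nR}$ for all sufficiently large $n$ and $P_e(\mathcal{C}^{(n)})\to0$; $C_{DC}$ is the supremum of achievable rates. *)

theory Defs
  imports "HOL-Analysis.Analysis" "Jordan_Normal_Form.Matrix"
begin

text \<open>Finite-dimensional quantum information in terms of complex square matrices.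
  Bipartite systems with A of dimension m and B of dimension k are represented on
  dimension m*k, index (a,b) corresponding to a*k + b (A is the first factor).\<close>

definition mtrace :: "complex mat \<Rightarrow> complex" where
  "mtrace A = (\<Sum>i<dim_row A. A $$ (i,i))"

definition adj :: "complex mat \<Rightarrow> complex mat" where
  "adj A = mat (dim_col A) (dim_row A) (\<lambda>(i,j). cnj (A $$ (j,i)))"

definition hermitian :: "nat \<Rightarrow> complex mat \<Rightarrow> bool" where
  "hermitian n A \<longleftrightarrow> A \<in> carrier_mat n n \<and> adj A = A"

definition psd :: "nat \<Rightarrow> complex mat \<Rightarrow> bool" where
  "psd n A \<longleftrightarrow> hermitian n A \<and>
     (\<forall>v \<in> carrier_vec n. 0 \<le> Re (\<Sum>i<n. cnj (v $ i) * (A *\<^sub>v v) $ i))"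

definition density :: "nat \<Rightarrow> complex mat \<Rightarrow> bool" where
  "density n A \<longleftrightarrow> psd n A \<and> mtrace A = 1"

definition unitary :: "nat \<Rightarrow> complex mat \<Rightarrow> bool" where
  "unitary n U \<longleftrightarrow> U \<in> carrier_mat n n \<and> U * adj U = 1\<^sub>m n \<and> adj U * U = 1\<^sub>m n"

text \<open>Spectral projection {A \<ge> 0}: for a spectral decomposition A = U D U* (U unitary,
  D real diagonal), the projection onto the span of eigenvectors with nonnegative
  eigenvalues.  (Independent of the chosen decomposition.)\<close>
definition nonneg_proj :: "nat \<Rightarrow> complex mat \<Rightarrow> complex mat" where
  "nonneg_proj n A = (SOME P. \<exists>U D. unitary n U \<and> D \<in> carrier_mat n n \<and> diagonal_mat D \<and>
      (\<forall>i<n. Im (D $$ (i,i)) = 0) \<and> A = U * D * adj U \<and>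
      P = U * mat n n (\<lambda>(i,j). if i = j \<and> 0 \<le> Re (D $$ (i,i)) then 1 else 0) * adj U)"

definition kron :: "nat \<Rightarrow> nat \<Rightarrow> complex mat \<Rightarrow> complex mat \<Rightarrow> complex mat" where
  "kron m k A B = mat (m*k) (m*k) (\<lambda>(r,c). A $$ (r div k, c div k) * B $$ (r mod k, c mod k))"

definition ptrace_A :: "nat \<Rightarrow> nat \<Rightarrow> complex mat \<Rightarrow> complex mat" where
  "ptrace_A m k X = mat k k (\<lambda>(b,b'). \<Sum>a<m. X $$ (a*k + b, a*k + b'))"

text \<open>(\<Phi> \<otimes> id_k) applied to an operator X on C^m \<otimes> C^k, for a linear map \<Phi> on m\<times>m matrices\<close>
definition apply_A :: "nat \<Rightarrow> nat \<Rightarrow> (complex mat \<Rightarrow> complex mat) \<Rightarrow> complex mat \<Rightarrow> complex mat" where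
  "apply_A m k \<Phi> X = mat (m*k) (m*k) (\<lambda>(r,c).
      \<Phi> (mat m m (\<lambda>(a,a'). X $$ (a*k + r mod k, a'*k + c mod k))) $$ (r div k, c div k))"

definition cptp :: "nat \<Rightarrow> (complex mat \<Rightarrow> complex mat) \<Rightarrow> bool" where
  "cptp m \<Phi> \<longleftrightarrow>
     (\<forall>X \<in> carrier_mat m m. \<Phi> X \<in> carrier_mat m m) \<and>
     (\<forall>X \<in> carrier_mat m m. \<forall>Y \<in> carrier_mat m m. \<Phi> (X + Y) = \<Phi> X + \<Phi> Y) \<and>
     (\<forall>X \<in> carrier_mat m m. \<forall>c. \<Phi> (c \<cdot>\<^sub>m X) = c \<cdot>\<^sub>m \<Phi> X) \<and>
     (\<forall>X \<in> carrier_mat m m. mtrace (\<Phi> X) = mtrace X) \<and>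
     (\<forall>k X. psd (m*k) X \<longrightarrow> psd (m*k) (apply_A m k \<Phi> X))"

definition cond_sup_entropy_rate ::
  "(nat \<Rightarrow> nat) \<Rightarrow> (nat \<Rightarrow> nat) \<Rightarrow> (nat \<Rightarrow> complex mat) \<Rightarrow> ereal" where
  "cond_sup_entropy_rate mA mB \<tau> = Inf (ereal ` {\<gamma>::real.
     liminf (\<lambda>n. let X = \<tau> n - complex_of_real (exp (- (real n * \<gamma>))) \<cdot>\<^sub>m
                          kron (mA n) (mB n) (1\<^sub>m (mA n)) (ptrace_A (mA n) (mB n) (\<tau> n))
                 in ereal (Re (mtrace (nonneg_proj (mA n * mB n) X * X)))) = 1})"

definition dc_achievable :: "nat \<Rightarrow> (nat \<Rightarrow> nat) \<Rightarrow> (nat \<Rightarrow> complex mat) \<Rightarrow> real \<Rightarrow> bool" where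
  "dc_achievable d dB \<rho> R \<longleftrightarrow>
    (\<exists>(M :: nat \<Rightarrow> nat) (Enc :: nat \<Rightarrow> nat \<Rightarrow> complex mat \<Rightarrow> complex mat)
       (Dec :: nat \<Rightarrow> nat \<Rightarrow> complex mat).
       (\<forall>n. \<forall>i < M n. cptp (d^n) (Enc n i)) \<and>
       (\<forall>n. \<forall>i < M n. psd (d^n * dB n) (Dec n i)) \<and>
       (\<forall>n. psd (d^n * dB n) (1\<^sub>m (d^n * dB n) - mat (d^n * dB n) (d^n * dB n) (\<lambda>(r,c). \<Sum>i<M n. Dec n i $$ (r,c)))) \<and>
       (\<forall>\<^sub>F n in sequentially. exp (real n * R) \<le> real (M n)) \<and>
       ((\<lambda>n. (1 / real (M n)) * (\<Sum>i<M n.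
            1 - Re (mtrace (apply_A (d^n) (dB n) (Enc n i) (\<rho> n) * Dec n i))))
          \<longlonglongrightarrow> 0))"

definition dc_capacity :: "nat \<Rightarrow> (nat \<Rightarrow> nat) \<Rightarrow> (nat \<Rightarrow> complex mat) \<Rightarrow> ereal" where
  "dc_capacity d dB \<rho> = Sup (ereal ` {R. dc_achievable d dB \<rho> R})"

end

theory Submission
  imports Defs "Jordan_Normal_Form.Spectral_Radius"
begin

text \<open>
  Converse: the projection {X \<ge> 0} maximises Tr(E X) over 0 \<le> E \<le> 1. Applied to
  X = \<tau> - e^{-n \<gamma>} 1 \<otimes> \<tau>_B for the codeword states \<tau> (which all have the same B-marginal) and
  averaged over the messages, it bounds the average of the quantities in the entropy rate from below by
  1 - P_e - e^{-n \<gamma>} d^n / M_n, so some encoder is a good choice of \<Lambda>_n.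

  Direct part: apply \<Lambda> followed by a Weyl unitary. Uniformly averaged over the Weyl unitaries the state
  becomes (1/d^n) 1 \<otimes> \<tau>_B, so codewords can be chosen greedily such that the sum of
  the overlaps of each new codeword with the tests of the earlier ones is small. The receiver performs the tests
  one after the other; Gao's quantum union bound controls the error.
\<close>

no_notation vec_nth (infixl "$" 90)

subsection \<open>Matrices\<close>

text \<open>One number controls both kinds of decoding error. Write P for the projection at
  threshold t, K for 1 \<otimes> \<tau>_B and m for the dimension of A. The quantity in the entropy
  rate is Tr(P \<tau>) - t Tr(P K), where Tr(P \<tau>) \<le> 1 and t Tr(P K) \<ge> 0. So the miss
  probability 1 - Tr(P \<tau>) and the scaled false alarm t Tr(P K) are each at most its distance
  from 1. The Weyl average turns one false alarm into Tr(P K) / m, so about t m earlier tests can be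
  afforded. In the converse the same product comes from Tr K = m: the loss is t m / M. With m = d^n
  and t = e^{-n \<gamma>} both halves meet at the exponent ln d - \<gamma>. Since the error is
  governed by the distance from 1, the direct part reaches R = ln d - \<gamma> itself; only the
  converse asks for a strict gap. Channels are known only through the abstract conditions of
  \<open>cptp\<close>, so composition with a unitary is verified on matrix blocks.\<close>

lemma mult_mat_index:
  assumes "A \<in> carrier_mat n m" "B \<in> carrier_mat m p" "i < n" "j < p"
  shows "(A * B) $$ (i,j) = (\<Sum>k<m. A $$ (i,k) * B $$ (k,j))"
  using assms by (auto simp: scalar_prod_def lessThan_atLeast0)

lemma mult_mat_vec_index:
  assumes "A \<in> carrier_mat n m" "v \<in> carrier_vec m" "i < n"
  shows "(A *\<^sub>v v) $ i = (\<Sum>k<m. A $$ (i,k) * v $ k)"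
  using assms by (auto simp: scalar_prod_def lessThan_atLeast0)

lemma adj_carrier [intro]: "A \<in> carrier_mat n m \<Longrightarrow> adj A \<in> carrier_mat m n"
  by (auto simp: adj_def)

lemma adj_dim [simp]: "dim_row (adj A) = dim_col A" "dim_col (adj A) = dim_row A"
  by (auto simp: adj_def)

lemma adj_index [simp]: "i < dim_col A \<Longrightarrow> j < dim_row A \<Longrightarrow> adj A $$ (i,j) = cnj (A $$ (j,i))"
  by (auto simp: adj_def)

lemma adj_adj [simp]: "adj (adj A) = A"
  by (rule eq_matI) auto

lemma adj_mult:
  assumes "A \<in> carrier_mat n m" "B \<in> carrier_mat m p"
  shows "adj (A * B) = adj B * adj A"
proof (rule eq_matI)
  fix i j assume "i < dim_row (adj B * adj A)" "j < dim_col (adj B * adj A)"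
  then have ij: "i < p" "j < n" using assms by auto
  have "adj (A * B) $$ (i,j) = cnj (\<Sum>k<m. A $$ (j,k) * B $$ (k,i))"
    using assms ij by (simp add: mult_mat_index[OF assms] del: index_mult_mat(1))
  also have "\<dots> = (adj B * adj A) $$ (i,j)"
    using assms ij
    by (subst mult_mat_index[OF adj_carrier[OF assms(2)] adj_carrier[OF assms(1)]])
      (auto simp: mult.commute intro!: sum.cong)
  finally show "adj (A * B) $$ (i,j) = (adj B * adj A) $$ (i,j)" .
qed (use assms in auto)

lemma adj_one [simp]: "adj (1\<^sub>m n) = 1\<^sub>m n"
  by (rule eq_matI) auto

lemma adj_minus:
  assumes "A \<in> carrier_mat n m" "B \<in> carrier_mat n m"
  shows "adj (A - B) = adj A - adj B"
  using assms by (intro eq_matI) auto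

lemma mtrace_mult:
  assumes "A \<in> carrier_mat n m" "B \<in> carrier_mat m n"
  shows "mtrace (A * B) = (\<Sum>i<n. \<Sum>k<m. A $$ (i,k) * B $$ (k,i))"
  using assms by (auto simp: mtrace_def mult_mat_index[OF assms] simp del: index_mult_mat(1) intro!: sum.cong)

lemma mtrace_mult_comm:
  assumes "A \<in> carrier_mat n m" "B \<in> carrier_mat m n"
  shows "mtrace (A * B) = mtrace (B * A)"
  unfolding mtrace_mult[OF assms] mtrace_mult[OF assms(2,1)]
  by (subst sum.swap) (simp add: mult.commute)

lemma mtrace_adj: "A \<in> carrier_mat n n \<Longrightarrow> mtrace (adj A) = cnj (mtrace A)"
  by (auto simp: mtrace_def)

lemma mtrace_minus:
  "A \<in> carrier_mat n n \<Longrightarrow> B \<in> carrier_mat n n \<Longrightarrow> mtrace (A - B) = mtrace A - mtrace B"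
  by (auto simp: mtrace_def sum_subtractf)

lemma mtrace_smult: "A \<in> carrier_mat n n \<Longrightarrow> mtrace (c \<cdot>\<^sub>m A) = c * mtrace A"
  by (auto simp: mtrace_def sum_distrib_left)

lemma psd_carrier: "psd n A \<Longrightarrow> A \<in> carrier_mat n n"
  by (simp add: psd_def hermitian_def)

lemma unitary_carrier: "unitary n U \<Longrightarrow> U \<in> carrier_mat n n"
  by (simp add: unitary_def)

section \<open>Unitary matrices and the spectral theorem\<close>

lemma unitary_mult:
  assumes "unitary n U" "unitary n V"
  shows "unitary n (U * V)"
proof -
  have c: "U \<in> carrier_mat n n" "V \<in> carrier_mat n n" "adj U \<in> carrier_mat n n" "adj V \<in> carrier_mat n n"
    using assms unitary_carrier by auto
  have "U * V * (adj V * adj U) = U * (V * adj V) * adj U"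
    using c by (simp add: assoc_mult_mat[of _ n n _ n _ n])
  also have "\<dots> = 1\<^sub>m n" using assms c by (simp add: unitary_def)
  finally have 1: "U * V * (adj V * adj U) = 1\<^sub>m n" .
  have "adj V * adj U * (U * V) = adj V * (adj U * U) * V"
    using c by (simp add: assoc_mult_mat[of _ n n _ n _ n])
  also have "\<dots> = 1\<^sub>m n" using assms c by (simp add: unitary_def)
  finally show ?thesis using 1 c by (simp add: unitary_def adj_mult[OF c(1,2)])
qed

text \<open>Gram-Schmidt on a basis completed from \<open>v\<close>, with normalised columns. Column
  0 is only proportional to \<open>v\<close>, which suffices because the eigenvector equation is
  homogeneous.\<close>

lemma unitary_extending_vec:
  assumes v: "v \<in> carrier_vec n" "v \<noteq> 0\<^sub>v n"
  obtains U c where "unitary n U" "\<And>i. i < n \<Longrightarrow> U $$ (i,0) = c * v $ i"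
proof -
  have n: "n \<noteq> 0" using v by (cases n) (auto intro: eq_vecI)
  interpret cof_vec_space n "TYPE(complex)" .
  define b where "b = basis_completion v"
  define ws where "ws = gram_schmidt n b"
  from basis_completion[OF v, folded b_def]
  have dist_b: "distinct b"
    and indep: "\<not> lin_dep (set b)" and b: "set b \<subseteq> carrier_vec n" and hdb: "hd b = v"
    and len_b: "length b = n" by auto
  from hdb len_b n obtain vs where bv: "b = v # vs" by (cases b, auto)
  from gram_schmidt_result[OF b dist_b indep refl, folded ws_def]
  have ws: "set ws \<subseteq> carrier_vec n" "corthogonal ws" "length ws = n"
    by (auto simp: len_b)
  from gram_schmidt_hd[OF v(1), of vs, folded bv] have hdws: "hd ws = v" unfolding ws_def .
  have wc: "ws ! i \<in> carrier_vec n" if "i < n" for i using ws that by auto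
  define s where "s i = (\<Sum>k<n. (cmod (ws ! i $ k))\<^sup>2)" for i
  have ip: "ws ! i \<bullet>c ws ! j = (\<Sum>k<n. ws ! i $ k * cnj (ws ! j $ k))" if "i < n" "j < n" for i j
    using wc[OF that(1)] wc[OF that(2)] by (auto simp: scalar_prod_def lessThan_atLeast0 intro!: sum.cong)
  have ips: "ws ! i \<bullet>c ws ! i = complex_of_real (s i)" if "i < n" for i
    unfolding ip[OF that that] s_def by (simp add: complex_norm_square[symmetric])
  have s0: "s i > 0" if "i < n" for i
  proof -
    \<comment> \<open>\<open>corthogonal\<close> is an equivalence: the product vanishes exactly for
      distinct indices. So it also yields the nonzero norms by which the columns are
      divided.\<close>
    have "ws ! i \<bullet>c ws ! i \<noteq> 0" using corthogonalD[OF ws(2)] ws(3) that by auto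
    then have "s i \<noteq> 0" using ips[OF that] by auto
    moreover have "s i \<ge> 0" unfolding s_def by (intro sum_nonneg) auto
    ultimately show ?thesis by simp
  qed
  define U where "U = mat n n (\<lambda>(i,j). ws ! j $ i / complex_of_real (sqrt (s j)))"
  have U: "U \<in> carrier_mat n n" by (simp add: U_def)
  have "adj U * U = 1\<^sub>m n"
  proof (rule eq_matI)
    fix i j assume "i < dim_row (1\<^sub>m n :: complex mat)" "j < dim_col (1\<^sub>m n :: complex mat)"
    then have ij: "i < n" "j < n" by auto
    have "(adj U * U) $$ (i,j) = (\<Sum>k<n. adj U $$ (i,k) * U $$ (k,j))"
      using mult_mat_index[OF adj_carrier[OF U] U] ij by auto
    also have "\<dots> = (\<Sum>k<n. ws ! j $ k * cnj (ws ! i $ k)) / complex_of_real (sqrt (s i) * sqrt (s j))"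
      using ij by (auto simp: U_def sum_divide_distrib intro!: sum.cong)
    also have "\<dots> = (ws ! j \<bullet>c ws ! i) / complex_of_real (sqrt (s i) * sqrt (s j))"
      using ip ij by simp
    also have "\<dots> = (1\<^sub>m n) $$ (i,j)"
    proof (cases "i = j")
      case True
      then show ?thesis using ips[of i] s0[of i] ij by simp
    next
      case False
      then have "ws ! j \<bullet>c ws ! i = 0" using corthogonalD[OF ws(2)] ws(3) ij by auto
      then show ?thesis using False ij by simp
    qed
    finally show "(adj U * U) $$ (i,j) = (1\<^sub>m n) $$ (i,j)" .
  qed (use U in auto)
  moreover from this have "U * adj U = 1\<^sub>m n"
    using mat_mult_left_right_inverse[OF adj_carrier[OF U] U] by simp
  ultimately have "unitary n U" using U by (simp add: unitary_def)
  moreover have "U $$ (i,0) = (1 / complex_of_real (sqrt (s 0))) * v $ i" if "i < n" for i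
  proof -
    have "ws ! 0 = v" using hdws ws(3) n by (metis hd_conv_nth length_0_conv)
    then show ?thesis using that n by (simp add: U_def)
  qed
  ultimately show thesis by (rule that)
qed

text \<open>The condition under the choice operator in \<open>nonneg_proj\<close>, named so that the
  same lemmas handle every decomposition which that operator may return.\<close>

definition spectral_decomp :: "nat \<Rightarrow> complex mat \<Rightarrow> complex mat \<Rightarrow> complex mat \<Rightarrow> bool" where
  "spectral_decomp n A U D \<longleftrightarrow> unitary n U \<and> D \<in> carrier_mat n n \<and> diagonal_mat D \<and>
     (\<forall>i<n. Im (D $$ (i,i)) = 0) \<and> A = U * D * adj U"

lemma unitary_conj_cancel:
  assumes "unitary n U" "A \<in> carrier_mat n n"
  shows "U * (adj U * A * U) * adj U = A"
proof -
  have c: "U \<in> carrier_mat n n" "adj U \<in> carrier_mat n n" using assms unitary_carrier by auto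
  have "U * (adj U * A * U) * adj U = (U * adj U) * A * (U * adj U)"
    using c assms(2) by (simp add: assoc_mult_mat[of _ n n _ n _ n])
  then show ?thesis using assms by (simp add: unitary_def)
qed

text \<open>Deflation: in an orthonormal basis that starts with an eigenvector, the first column is
  \<open>e\<close> times a unit vector, Hermitian symmetry clears the first row too, and the
  induction hypothesis diagonalises the remaining block.\<close>

theorem hermitian_spectral_decomp:
  assumes "hermitian n A"
  shows "\<exists>U D. spectral_decomp n A U D"
  using assms
proof (induction n arbitrary: A)
  case 0
  then have "spectral_decomp 0 A (1\<^sub>m 0) A"
    by (auto simp: spectral_decomp_def unitary_def hermitian_def diagonal_mat_def intro!: eq_matI)
  then show ?case by blast
next
  case (Suc m)
  let ?n = "Suc m"
  have A: "A \<in> carrier_mat ?n ?n" and hA: "adj A = A" using Suc.prems by (auto simp: hermitian_def)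
  obtain e v where ev: "eigenvector A v e"
    using spectrum_non_empty[OF A] by (auto simp: spectrum_def eigenvalue_def)
  then have v: "v \<in> carrier_vec ?n" "v \<noteq> 0\<^sub>v ?n" "A *\<^sub>v v = e \<cdot>\<^sub>v v"
    using A by (auto simp: eigenvector_def)
  obtain W c where W: "unitary ?n W" and Wc: "\<And>i. i < ?n \<Longrightarrow> W $$ (i,0) = c * v $ i"
    using unitary_extending_vec[OF v(1,2)] by blast
  have Wcar: "W \<in> carrier_mat ?n ?n" "adj W \<in> carrier_mat ?n ?n" using W unitary_carrier by auto
  define B where "B = adj W * A * W"
  have B: "B \<in> carrier_mat ?n ?n" using Wcar A by (auto simp: B_def)
  have hB: "adj B = B"
    using Wcar A hA by (simp add: B_def adj_mult[of _ ?n ?n _ ?n] assoc_mult_mat[of _ ?n ?n _ ?n _ ?n])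
  have AW: "(A * W) $$ (i,0) = e * W $$ (i,0)" if "i < ?n" for i
  proof -
    have "(A * W) $$ (i,0) = (\<Sum>k<?n. A $$ (i,k) * W $$ (k,0))"
      using mult_mat_index[OF A Wcar(1) that] by auto
    also have "\<dots> = c * (A *\<^sub>v v) $ i"
      unfolding mult_mat_vec_index[OF A v(1) that] sum_distrib_left
      by (rule sum.cong) (auto simp: Wc)
    also have "\<dots> = e * W $$ (i,0)" using v that by (simp add: Wc)
    finally show ?thesis .
  qed
  have B0: "B $$ (i,0) = (if i = 0 then e else 0)" if "i < ?n" for i
  proof -
    have "B = adj W * (A * W)" using Wcar A by (simp add: B_def)
    then have "B $$ (i,0) = (\<Sum>k<?n. adj W $$ (i,k) * (A * W) $$ (k,0))"
      using mult_mat_index[OF Wcar(2), of "A * W" ?n i 0] A Wcar that by auto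
    also have "\<dots> = e * (\<Sum>k<?n. adj W $$ (i,k) * W $$ (k,0))"
      unfolding sum_distrib_left by (rule sum.cong) (auto simp: AW simp del: index_mult_mat(1))
    also have "\<dots> = e * (adj W * W) $$ (i,0)"
      using mult_mat_index[OF Wcar(2,1) that] by auto
    also have "\<dots> = (if i = 0 then e else 0)" using W that by (simp add: unitary_def)
    finally show ?thesis .
  qed
  have Bsym: "B $$ (i,j) = cnj (B $$ (j,i))" if "i < ?n" "j < ?n" for i j
    using adj_index[of i B j] hB B that by auto
  define C where "C = mat m m (\<lambda>(i,j). B $$ (Suc i, Suc j))"
  have "adj C = C"
  proof (rule eq_matI)
    fix i j assume "i < dim_row C" "j < dim_col C"
    then show "adj C $$ (i,j) = C $$ (i,j)" using Bsym[of "Suc i" "Suc j"] by (simp add: C_def)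
  qed (auto simp: C_def)
  then have "hermitian m C" by (simp add: hermitian_def C_def)
  then obtain V E where VE: "spectral_decomp m C V E" using Suc.IH by blast
  have V: "V \<in> carrier_mat m m" "adj V \<in> carrier_mat m m" and E: "E \<in> carrier_mat m m"
    and C: "C \<in> carrier_mat m m"
    using VE by (auto simp: spectral_decomp_def C_def unitary_def)
  let ?e = "mat 1 1 (\<lambda>_. e)"
  let ?F = "\<lambda>X Y. four_block_mat X (0\<^sub>m 1 m) (0\<^sub>m m 1) Y"
  have FC: "?F X Y \<in> carrier_mat ?n ?n" if "X \<in> carrier_mat 1 1" "Y \<in> carrier_mat m m" for X Y :: "complex mat"
    using four_block_carrier_mat[OF that] by simp
  have Fmult: "?F X Y * ?F X' Y' = ?F (X * X') (Y * Y')"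
    if "X \<in> carrier_mat 1 1" "Y \<in> carrier_mat m m" "X' \<in> carrier_mat 1 1" "Y' \<in> carrier_mat m m"
    for X Y X' Y' :: "complex mat"
    using that by (subst mult_four_block_mat[of _ 1 1 _ m _ m]) auto
  have Fadj: "adj (?F (1\<^sub>m 1) Y) = ?F (1\<^sub>m 1) (adj Y)" if "Y \<in> carrier_mat m m" for Y
    using that by (intro eq_matI) auto
  have B0': "B $$ (0,i) = (if i = 0 then e else 0)" if "i < ?n" for i
    using Bsym[of 0 i] B0[OF that] B0[of 0] that by auto
  have BF: "B = ?F ?e C"
  proof (rule eq_matI)
    fix i j assume "i < dim_row (?F ?e C)" "j < dim_col (?F ?e C)"
    then have "i < ?n" "j < ?n" using C by auto
    then show "B $$ (i,j) = ?F ?e C $$ (i,j)"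
      using B0[of i] B0'[of j] C by (cases i; cases j) (auto simp: C_def)
  qed (use B C in auto)
  have "unitary ?n (?F (1\<^sub>m 1) V)"
    using VE V FC[of "1\<^sub>m 1" V] by (simp add: unitary_def spectral_decomp_def Fadj Fmult plus_1_eq_Suc del: One_nat_def)
  then have U: "unitary ?n (W * ?F (1\<^sub>m 1) V)" using unitary_mult W by blast
  \<comment> \<open>The eigenvalue is a corner entry of a Hermitian matrix, hence equal to its own
    conjugate.\<close>
  have eR: "Im e = 0" using arg_cong[OF Bsym[of 0 0], of Im] B0[of 0] by simp
  have "B = ?F (1\<^sub>m 1) V * ?F ?e E * adj (?F (1\<^sub>m 1) V)"
  proof -
    have "?F (1\<^sub>m 1) V * ?F ?e E * adj (?F (1\<^sub>m 1) V) = ?F (1\<^sub>m 1 * ?e * 1\<^sub>m 1) (V * E * adj V)"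
      using V E by (simp add: Fadj Fmult del: One_nat_def)
    moreover have "1\<^sub>m 1 * ?e * 1\<^sub>m 1 = ?e" by (subst right_mult_one_mat) auto
    ultimately show ?thesis using VE BF by (simp add: spectral_decomp_def)
  qed
  then have "A = W * (?F (1\<^sub>m 1) V * ?F ?e E * adj (?F (1\<^sub>m 1) V)) * adj W"
    using unitary_conj_cancel[OF W A] B_def by simp
  also have "\<dots> = (W * ?F (1\<^sub>m 1) V) * ?F ?e E * adj (W * ?F (1\<^sub>m 1) V)"
    using Wcar FC[of "1\<^sub>m 1" V] FC[of ?e E] adj_carrier[OF FC[of "1\<^sub>m 1" V]] V E
    by (simp add: adj_mult[of _ ?n ?n _ ?n] assoc_mult_mat[of _ ?n ?n _ ?n _ ?n])
  finally have "A = (W * ?F (1\<^sub>m 1) V) * ?F ?e E * adj (W * ?F (1\<^sub>m 1) V)" .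
  moreover have "diagonal_mat (?F ?e E)" "\<forall>i<?n. Im (?F ?e E $$ (i,i)) = 0"
    using VE E eR by (auto simp: diagonal_mat_def spectral_decomp_def)
  ultimately have "spectral_decomp ?n A (W * ?F (1\<^sub>m 1) V) (?F ?e E)"
    using U FC[of ?e E] E by (auto simp: spectral_decomp_def)
  then show ?case by blast
qed

subsection \<open>Positive semidefinite matrices and spectral projections\<close>

text \<open>The adjoint relation of the standard inner product, in the explicit sums through which
  \<open>psd\<close> is defined.\<close>

lemma cnj_sum_adj:
  assumes "M \<in> carrier_mat n m" "v \<in> carrier_vec m" "w \<in> carrier_vec n"
  shows "(\<Sum>i<n. cnj ((M *\<^sub>v v) $ i) * w $ i) = (\<Sum>i<m. cnj (v $ i) * (adj M *\<^sub>v w) $ i)"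
proof -
  have "(\<Sum>i<n. cnj ((M *\<^sub>v v) $ i) * w $ i) = (\<Sum>i<n. \<Sum>k<m. cnj (M $$ (i,k)) * cnj (v $ k) * w $ i)"
    by (rule sum.cong) (auto simp: mult_mat_vec_index[OF assms(1,2)] sum_distrib_right simp del: index_mult_mat_vec)
  also have "\<dots> = (\<Sum>k<m. \<Sum>i<n. cnj (M $$ (i,k)) * cnj (v $ k) * w $ i)" by (rule sum.swap)
  also have "\<dots> = (\<Sum>k<m. cnj (v $ k) * (adj M *\<^sub>v w) $ k)"
    using assms
    by (intro sum.cong) (auto simp: mult_mat_vec_index[OF adj_carrier[OF assms(1)] assms(3)] sum_distrib_left
        mult_ac simp del: index_mult_mat_vec intro!: sum.cong)
  finally show ?thesis .
qed

lemma psd_conj: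
  assumes "psd n A" "B \<in> carrier_mat n m"
  shows "psd m (adj B * A * B)"
proof -
  have A: "A \<in> carrier_mat n n" "adj A = A" using assms(1) by (auto simp: psd_def hermitian_def)
  have B: "adj B \<in> carrier_mat m n" using assms(2) by auto
  have "adj (adj B * A * B) = adj B * (adj A * B)"
    using A assms(2) B by (simp add: adj_mult[of _ m n _ m] adj_mult[of _ n n _ m])
  then have h: "hermitian m (adj B * A * B)" using A assms(2) B by (simp add: hermitian_def)
  have "0 \<le> Re (\<Sum>i<m. cnj (v $ i) * ((adj B * A * B) *\<^sub>v v) $ i)" if v: "v \<in> carrier_vec m" for v
  proof -
    have Bv: "B *\<^sub>v v \<in> carrier_vec n" using assms(2) v by simp
    have "(adj B * A * B) *\<^sub>v v = adj B *\<^sub>v (A *\<^sub>v (B *\<^sub>v v))"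
      using A assms(2) B v by (simp add: assoc_mult_mat_vec[of _ m n _ m] assoc_mult_mat_vec[of _ m n _ n] assoc_mult_mat[of _ m n _ n _ m] assoc_mult_mat_vec[of _ n n _ m])
    then have "(\<Sum>i<m. cnj (v $ i) * ((adj B * A * B) *\<^sub>v v) $ i) =
       (\<Sum>i<n. cnj ((B *\<^sub>v v) $ i) * (A *\<^sub>v (B *\<^sub>v v)) $ i)"
      using cnj_sum_adj[OF assms(2) v, of "A *\<^sub>v (B *\<^sub>v v)"] A Bv by simp
    then show ?thesis using assms(1) Bv by (simp add: psd_def)
  qed
  then show ?thesis using h by (simp add: psd_def)
qed

lemma psd_one: "psd n (1\<^sub>m n)"
  by (auto simp: psd_def hermitian_def sum_nonneg)

lemma psd_adj_mult: "B \<in> carrier_mat n m \<Longrightarrow> psd m (adj B * B)"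
  using psd_conj[OF psd_one, of B n m] by auto

lemma psd_diag_nonneg:
  assumes "psd n A" "i < n"
  shows "0 \<le> Re (A $$ (i,i))"
proof -
  have A: "A \<in> carrier_mat n n" using assms psd_carrier by auto
  have "(A *\<^sub>v unit_vec n i) $ j = A $$ (j,i)" if "j < n" for j
    using A assms that by simp
  then have "(\<Sum>j<n. cnj (unit_vec n i $ j) * (A *\<^sub>v unit_vec n i) $ j) = (\<Sum>j<n. if j = i then A $$ (i,i) else 0)"
    using assms by (intro sum.cong) auto
  also have "\<dots> = A $$ (i,i)" using assms by simp
  finally show ?thesis using assms unfolding psd_def by (metis unit_vec_carrier)
qed

lemma psd_sum:
  assumes "\<And>i. i \<in> I \<Longrightarrow> psd n (A i)"
  shows "psd n (mat n n (\<lambda>(r,c). \<Sum>i\<in>I. A i $$ (r,c)))" (is "psd n ?S")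
proof -
  have c: "A i \<in> carrier_mat n n" "adj (A i) = A i" if "i \<in> I" for i
    using assms[OF that] by (auto simp: psd_def hermitian_def)
  have "cnj (A i $$ (s,r)) = A i $$ (r,s)" if "i \<in> I" "r < n" "s < n" for i r s
    using adj_index[of r "A i" s] c[OF that(1)] that by auto
  then have h: "hermitian n ?S"
    by (auto simp: hermitian_def intro!: eq_matI sum.cong)
  have "0 \<le> Re (\<Sum>k<n. cnj (v $ k) * (?S *\<^sub>v v) $ k)" if v: "v \<in> carrier_vec n" for v
  proof -
    have "(\<Sum>k<n. cnj (v $ k) * (?S *\<^sub>v v) $ k)
      = (\<Sum>k<n. \<Sum>i\<in>I. cnj (v $ k) * (A i *\<^sub>v v) $ k)"
    proof (rule sum.cong)
      fix k assume k: "k \<in> {..<n}"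
      have "(?S *\<^sub>v v) $ k = (\<Sum>l<n. \<Sum>i\<in>I. A i $$ (k,l) * v $ l)"
        using k v by (subst mult_mat_vec_index[of _ n n]) (auto simp: sum_distrib_right)
      also have "\<dots> = (\<Sum>i\<in>I. (A i *\<^sub>v v) $ k)"
        using k v c by (subst sum.swap) (auto simp: mult_mat_vec_index[of _ n n] simp del: index_mult_mat_vec intro!: sum.cong)
      finally show "cnj (v $ k) * (?S *\<^sub>v v) $ k = (\<Sum>i\<in>I. cnj (v $ k) * (A i *\<^sub>v v) $ k)"
        by (simp add: sum_distrib_left)
    qed simp
    also have "\<dots> = (\<Sum>i\<in>I. \<Sum>k<n. cnj (v $ k) * (A i *\<^sub>v v) $ k)" by (rule sum.swap)
    finally have "Re (\<Sum>k<n. cnj (v $ k) * (?S *\<^sub>v v) $ k)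
      = (\<Sum>i\<in>I. Re (\<Sum>k<n. cnj (v $ k) * (A i *\<^sub>v v) $ k))" by (simp only: Re_sum)
    also have "\<dots> \<ge> 0" using assms v unfolding psd_def by (intro sum_nonneg) blast
    finally show ?thesis .
  qed
  then show ?thesis using h by (simp add: psd_def)
qed

lemma psd_scale:
  assumes "psd n A" "0 \<le> t"
  shows "psd n (complex_of_real t \<cdot>\<^sub>m A)"
proof -
  have A: "A \<in> carrier_mat n n" using assms psd_carrier by auto
  have adjA: "adj A = A" using assms(1) by (simp add: psd_def hermitian_def)
  have "adj (complex_of_real t \<cdot>\<^sub>m A) = complex_of_real t \<cdot>\<^sub>m adj A"
    by (rule eq_matI) auto
  moreover have "(\<Sum>i<n. cnj (v $ i) * ((complex_of_real t \<cdot>\<^sub>m A) *\<^sub>v v) $ i)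
      = complex_of_real t * (\<Sum>i<n. cnj (v $ i) * (A *\<^sub>v v) $ i)" if "v \<in> carrier_vec n" for v
    unfolding sum_distrib_left using A that by (intro sum.cong) (auto simp: mult_ac)
  ultimately show ?thesis using A adjA assms by (simp add: psd_def hermitian_def del: Re_sum)
qed

text \<open>By cyclicity the trace is taken in the eigenbasis of \<open>A\<close>, where the
  diagonal \<open>D\<close> sees only diagonal entries of \<open>B\<close>. Trace inequalities
  thereby reduce to inequalities between diagonal entries.\<close>

lemma mtrace_spectral:
  assumes "spectral_decomp n A U D" "B \<in> carrier_mat n n"
  shows "mtrace (B * A) = (\<Sum>i<n. (adj U * B * U) $$ (i,i) * D $$ (i,i))"
proof -
  have c: "U \<in> carrier_mat n n" "adj U \<in> carrier_mat n n" "D \<in> carrier_mat n n"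
    using assms(1) unitary_carrier by (auto simp: spectral_decomp_def)
  have "mtrace (B * A) = mtrace ((B * U * D) * adj U)"
    using assms c by (simp add: spectral_decomp_def assoc_mult_mat[of _ n n _ n _ n])
  also have "\<dots> = mtrace (adj U * (B * U * D))"
    using assms c by (intro mtrace_mult_comm[of _ n n]) auto
  also have "\<dots> = mtrace ((adj U * B * U) * D)"
    using assms c by (simp add: assoc_mult_mat[of _ n n _ n _ n])
  also have "\<dots> = (\<Sum>i<n. \<Sum>k<n. (adj U * B * U) $$ (i,k) * D $$ (k,i))"
    using assms c by (intro mtrace_mult) auto
  also have "\<dots> = (\<Sum>i<n. \<Sum>k<n. if k = i then (adj U * B * U) $$ (i,i) * D $$ (i,i) else 0)"
    using assms(1) c by (intro sum.cong) (auto simp: spectral_decomp_def diagonal_mat_def)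
  also have "\<dots> = (\<Sum>i<n. (adj U * B * U) $$ (i,i) * D $$ (i,i))"
    by (intro sum.cong) auto
  finally show ?thesis .
qed

lemma spectral_decomp_conj:
  assumes "spectral_decomp n A U D"
  shows "adj U * A * U = D"
proof -
  have c: "U \<in> carrier_mat n n" "adj U \<in> carrier_mat n n" "D \<in> carrier_mat n n" "adj U * U = 1\<^sub>m n"
    using assms unitary_carrier by (auto simp: spectral_decomp_def unitary_def)
  have "adj U * A * U = (adj U * U) * D * (adj U * U)"
    using assms c(1-3) by (simp add: spectral_decomp_def assoc_mult_mat[of _ n n _ n _ n])
  then show ?thesis using c by simp
qed

text \<open>In the eigenbasis of \<open>A\<close> the trace is a sum of products of diagonal entries
  of two psd matrices; \<open>D\<close> is psd because it is a unitary conjugate of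
  \<open>A\<close>.\<close>

theorem psd_mtrace_mult_nonneg:
  assumes "psd n A" "psd n B"
  shows "0 \<le> Re (mtrace (B * A))"
proof -
  obtain U D where UD: "spectral_decomp n A U D"
    using hermitian_spectral_decomp[of n A] assms(1) unfolding psd_def by blast
  then have U: "U \<in> carrier_mat n n" and D: "\<And>i. i < n \<Longrightarrow> Im (D $$ (i,i)) = 0"
    by (auto simp: spectral_decomp_def unitary_def)
  have "psd n D" using psd_conj[OF assms(1) U] spectral_decomp_conj[OF UD] by simp
  moreover have "psd n (adj U * B * U)" using psd_conj[OF assms(2) U] .
  ultimately show ?thesis
    unfolding mtrace_spectral[OF UD psd_carrier[OF assms(2)]]
    by (auto simp: Re_sum D simp del: index_mult_mat intro!: sum_nonneg mult_nonneg_nonneg psd_diag_nonneg)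
qed

section \<open>Orthogonal projections and optimal tests\<close>

definition projector :: "nat \<Rightarrow> complex mat \<Rightarrow> bool" where
  "projector n P \<longleftrightarrow> P \<in> carrier_mat n n \<and> adj P = P \<and> P * P = P"

lemma projector_psd: "projector n P \<Longrightarrow> psd n P"
  using psd_adj_mult[of P n n] by (auto simp: projector_def)

lemma projector_compl:
  assumes "projector n P"
  shows "projector n (1\<^sub>m n - P)"
proof -
  have c: "P \<in> carrier_mat n n" "adj P = P" "P * P = P" using assms by (auto simp: projector_def)
  have "(1\<^sub>m n - P) * (1\<^sub>m n - P) = (1\<^sub>m n - P) * 1\<^sub>m n - (1\<^sub>m n - P) * P"
    using c(1) by (intro mult_minus_distrib_mat[of _ n n]) auto
  also have "(1\<^sub>m n - P) * P = P - P"
    using c by (subst minus_mult_distrib_mat[of _ n n]) auto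
  also have "(1\<^sub>m n - P) * 1\<^sub>m n - (P - P) = 1\<^sub>m n - P"
    using c(1) by (intro eq_matI) auto
  finally have "(1\<^sub>m n - P) * (1\<^sub>m n - P) = 1\<^sub>m n - P" .
  moreover have "adj (1\<^sub>m n - P) = 1\<^sub>m n - P" using c by (simp add: adj_minus[of _ n n])
  moreover have "1\<^sub>m n - P \<in> carrier_mat n n" using c by (simp add: minus_carrier_mat)
  ultimately show ?thesis unfolding projector_def by blast
qed

lemma projector_conj:
  assumes "projector n P" "unitary n U"
  shows "projector n (U * P * adj U)"
proof -
  have c: "P \<in> carrier_mat n n" "adj P = P" "P * P = P"
    and u: "U \<in> carrier_mat n n" "adj U \<in> carrier_mat n n" "adj U * U = 1\<^sub>m n"
    using assms by (auto simp: projector_def unitary_def)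
  have "adj (U * P * adj U) = U * P * adj U"
    using c u by (simp add: adj_mult[of _ n n _ n] assoc_mult_mat[of _ n n _ n _ n])
  moreover have "U * P * adj U * (U * P * adj U) = U * (P * ((adj U * U) * P)) * adj U"
    using c(1) u(1,2) by (simp add: assoc_mult_mat[of _ n n _ n _ n])
  ultimately show ?thesis using c u by (simp add: projector_def)
qed

text \<open>In the eigenbasis of \<open>X\<close> a test between 0 and 1 has diagonal entries in
  [0,1], so it collects at most the positive part of each eigenvalue; the projection collects
  exactly that. The argument applies to whichever decomposition the choice operator returns.\<close>

theorem nonneg_proj_optimal:
  assumes "hermitian n X"
  shows "projector n (nonneg_proj n X)"
    and "\<And>E. psd n E \<Longrightarrow> psd n (1\<^sub>m n - E) \<Longrightarrow> Re (mtrace (E * X)) \<le> Re (mtrace (nonneg_proj n X * X))"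
proof -
  let ?Q = "\<lambda>D. mat n n (\<lambda>(i,j). if i = j \<and> 0 \<le> Re (D $$ (i,i)) then 1 else 0) :: complex mat"
  have ex: "\<exists>P U D. unitary n U \<and> D \<in> carrier_mat n n \<and> diagonal_mat D \<and>
      (\<forall>i<n. Im (D $$ (i,i)) = 0) \<and> X = U * D * adj U \<and> P = U * ?Q D * adj U"
    using hermitian_spectral_decomp[OF assms] unfolding spectral_decomp_def by blast
  from someI_ex[OF ex, folded nonneg_proj_def]
  obtain U D where UD: "spectral_decomp n X U D" and P: "nonneg_proj n X = U * ?Q D * adj U"
    unfolding spectral_decomp_def by blast
  have u: "unitary n U" "U \<in> carrier_mat n n" "adj U \<in> carrier_mat n n" "adj U * U = 1\<^sub>m n"
    and D: "\<And>i. i < n \<Longrightarrow> Im (D $$ (i,i)) = 0"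
    using UD by (auto simp: spectral_decomp_def unitary_def)
  have Q: "?Q D \<in> carrier_mat n n" by simp
  have "?Q D * ?Q D = ?Q D"
  proof (rule eq_matI)
    fix i j assume "i < dim_row (?Q D)" "j < dim_col (?Q D)"
    then have ij: "i < n" "j < n" by auto
    have "(?Q D * ?Q D) $$ (i,j) = (\<Sum>k<n. if k = i then ?Q D $$ (i,j) else 0)"
      unfolding mult_mat_index[OF Q Q ij] using ij by (intro sum.cong) auto
    then show "(?Q D * ?Q D) $$ (i,j) = ?Q D $$ (i,j)" using ij by simp
  qed auto
  moreover have "adj (?Q D) = ?Q D" by (rule eq_matI) auto
  ultimately have "projector n (?Q D)" by (simp add: projector_def)
  then show proj: "projector n (nonneg_proj n X)" using projector_conj u P by simp
  fix E assume E: "psd n E" "psd n (1\<^sub>m n - E)"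
  have Ec: "E \<in> carrier_mat n n" using E psd_carrier by auto
  have "adj U * (1\<^sub>m n - E) * U = (adj U - adj U * E) * U"
    using u Ec by (subst mult_minus_distrib_mat[of _ n n]) auto
  also have "\<dots> = 1\<^sub>m n - adj U * E * U"
    using u Ec by (subst minus_mult_distrib_mat[of _ n n]) auto
  finally have le: "psd n (1\<^sub>m n - adj U * E * U)" using psd_conj[OF E(2) u(2)] by simp
  have ge: "psd n (adj U * E * U)" using psd_conj[OF E(1) u(2)] .
  \<comment> \<open>Cancelling with \<open>adj U\<close> in the place of \<open>U\<close> brings the
    projection back to its diagonal of zeros and ones.\<close>
  have "unitary n (adj U)" using u(1) by (auto simp: unitary_def)
  from unitary_conj_cancel[OF this Q] have UPU: "adj U * (U * ?Q D * adj U) * U = ?Q D" by (simp only: adj_adj)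
  have EX: "mtrace (E * X) = (\<Sum>i<n. (adj U * E * U) $$ (i,i) * D $$ (i,i))"
    by (rule mtrace_spectral[OF UD Ec])
  have "mtrace (nonneg_proj n X * X) = (\<Sum>i<n. (adj U * (U * ?Q D * adj U) * U) $$ (i,i) * D $$ (i,i))"
    unfolding P by (rule mtrace_spectral[OF UD]) (use u Q in \<open>intro mult_carrier_mat\<close>)
  then have PX: "mtrace (nonneg_proj n X * X) = (\<Sum>i<n. ?Q D $$ (i,i) * D $$ (i,i))" unfolding UPU .
  show "Re (mtrace (E * X)) \<le> Re (mtrace (nonneg_proj n X * X))"
    unfolding EX PX Re_sum
  proof (rule sum_mono)
    fix i assume "i \<in> {..<n}"
    then have i: "i < n" by simp
    define F where "F = adj U * E * U"
    have Fc: "F \<in> carrier_mat n n" using u Ec by (simp add: F_def)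
    have "0 \<le> Re (F $$ (i,i))" using psd_diag_nonneg[OF ge i] by (simp only: F_def)
    moreover have "Re (F $$ (i,i)) \<le> 1" using psd_diag_nonneg[OF le i] i Fc unfolding F_def[symmetric] by simp
    ultimately have "Re (F $$ (i,i)) * Re (D $$ (i,i)) \<le> (if 0 \<le> Re (D $$ (i,i)) then Re (D $$ (i,i)) else 0)"
      by (auto simp: mult_left_le_one_le mult_nonneg_nonpos)
    then show "Re ((adj U * E * U) $$ (i,i) * D $$ (i,i)) \<le> Re (?Q D $$ (i,i) * D $$ (i,i))"
      unfolding F_def[symmetric] using i D[OF i] by (cases "0 \<le> Re (D $$ (i,i))") auto
  qed
qed

subsection \<open>Bipartite systems\<close>

lemma bipartite_index_less: "a < m \<Longrightarrow> b < k \<Longrightarrow> a * k + b < m * (k::nat)"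
proof -
  assume "a < m" "b < k"
  then have "a * k + b < Suc a * k" by simp
  also have "Suc a * k \<le> m * k" using \<open>a < m\<close> by (intro mult_le_mono1) simp
  finally show ?thesis .
qed

lemma sum_bipartite:
  fixes f :: "nat \<Rightarrow> 'a::comm_monoid_add"
  shows "(\<Sum>r<m*k. f r) = (\<Sum>a<m. \<Sum>b<k. f (a*k + b))"
proof -
  have "(\<Sum>r<m*k. f r) = (\<Sum>a<m. sum f {a*k..<a*k+k})" by (rule sum.nat_group[symmetric])
  also have "\<dots> = (\<Sum>a<m. \<Sum>b<k. f (a*k + b))"
  proof (rule sum.cong)
    fix a
    show "sum f {a*k..<a*k+k} = (\<Sum>b<k. f (a*k + b))"
      using sum.shift_bounds_nat_ivl[of f 0 "a*k" k] by (simp add: lessThan_atLeast0 add.commute)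
  qed simp
  finally show ?thesis .
qed

lemma bipartite_eqI:
  assumes "X \<in> carrier_mat (m*k) (m*k)" "Y \<in> carrier_mat (m*k) (m*k)"
    and "\<And>a a' b b'. a < m \<Longrightarrow> a' < m \<Longrightarrow> b < k \<Longrightarrow> b' < k \<Longrightarrow>
       X $$ (a*k+b, a'*k+b') = Y $$ (a*k+b, a'*k+b')"
  shows "X = Y"
proof (rule eq_matI)
  fix r c assume "r < dim_row Y" "c < dim_col Y"
  then have rc: "r < m*k" "c < m*k" using assms(2) by auto
  then have "k > 0" by (cases k) auto
  then have "r div k < m" "c div k < m" "r mod k < k" "c mod k < k"
    using rc by (auto simp: less_mult_imp_div_less)
  from assms(3)[OF this] show "X $$ (r,c) = Y $$ (r,c)" by simp
qed (use assms in auto)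

lemma kron_carrier [simp]: "kron m k A B \<in> carrier_mat (m*k) (m*k)"
  by (simp add: kron_def)

lemma kron_dim [simp]: "dim_row (kron m k A B) = m*k" "dim_col (kron m k A B) = m*k"
  by (auto simp: kron_def)

lemma kron_index:
  assumes "a < m" "a' < m" "b < k" "b' < k"
  shows "kron m k A B $$ (a*k+b, a'*k+b') = A $$ (a,a') * B $$ (b,b')"
  using assms by (simp add: kron_def bipartite_index_less)

lemma kron_mult:
  assumes "A \<in> carrier_mat m m" "C \<in> carrier_mat m m" "B \<in> carrier_mat k k" "E \<in> carrier_mat k k"
  shows "kron m k A B * kron m k C E = kron m k (A * C) (B * E)"
proof (rule bipartite_eqI[of _ m k])
  fix a a' b b' assume ab: "a < m" "a' < m" "b < k" "b' < k"
  have "(kron m k A B * kron m k C E) $$ (a*k+b, a'*k+b')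
     = (\<Sum>e<m. \<Sum>f<k. (A $$ (a,e) * B $$ (b,f)) * (C $$ (e,a') * E $$ (f,b')))"
    using ab by (subst mult_mat_index[of _ "m*k" "m*k" _ "m*k"])
      (auto simp: bipartite_index_less sum_bipartite kron_index intro!: sum.cong)
  also have "\<dots> = (\<Sum>e<m. A $$ (a,e) * C $$ (e,a')) * (\<Sum>f<k. B $$ (b,f) * E $$ (f,b'))"
    unfolding sum_product by (intro sum.cong) (auto simp: mult_ac)
  also have "\<dots> = kron m k (A * C) (B * E) $$ (a*k+b, a'*k+b')"
    using ab by (simp add: kron_index mult_mat_index[OF assms(1,2)] mult_mat_index[OF assms(3,4)] del: index_mult_mat(1))
  finally show "(kron m k A B * kron m k C E) $$ (a*k+b, a'*k+b') = kron m k (A * C) (B * E) $$ (a*k+b, a'*k+b')" .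
qed auto

lemma adj_kron:
  assumes "A \<in> carrier_mat m m" "B \<in> carrier_mat k k"
  shows "adj (kron m k A B) = kron m k (adj A) (adj B)"
  using assms by (intro bipartite_eqI[of _ m k]) (auto simp: kron_index bipartite_index_less)

lemma kron_one_one: "kron m k (1\<^sub>m m) (1\<^sub>m k) = 1\<^sub>m (m*k)"
proof (rule bipartite_eqI[of _ m k])
  fix a a' b b' assume ab: "a < m" "a' < m" "b < k" "b' < k"
  have "a*k+b = a'*k+b' \<longleftrightarrow> a = a' \<and> b = b'"
  proof
    assume eq: "a*k+b = a'*k+b'"
    have "(a*k+b) div k = a" "(a'*k+b') div k = a'" "(a*k+b) mod k = b" "(a'*k+b') mod k = b'"
      using ab by auto
    then show "a = a' \<and> b = b'" using eq by metis
  qed auto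
  then show "kron m k (1\<^sub>m m) (1\<^sub>m k) $$ (a*k+b, a'*k+b') = 1\<^sub>m (m*k) $$ (a*k+b, a'*k+b')"
    using ab by (auto simp: kron_index bipartite_index_less)
qed auto

section \<open>Local operators and channels on the first factor\<close>

definition local_op :: "nat \<Rightarrow> nat \<Rightarrow> complex mat \<Rightarrow> complex mat" where
  "local_op m k W = kron m k W (1\<^sub>m k)"

lemma local_op_carrier [simp]: "local_op m k W \<in> carrier_mat (m*k) (m*k)"
  by (simp add: local_op_def)

lemma adj_local_op: "W \<in> carrier_mat m m \<Longrightarrow> adj (local_op m k W) = local_op m k (adj W)"
  by (simp add: local_op_def adj_kron)

lemma local_op_unitary:
  assumes "unitary m W"
  shows "unitary (m*k) (local_op m k W)"
proof -
  have W: "W \<in> carrier_mat m m" "adj W \<in> carrier_mat m m" "W * adj W = 1\<^sub>m m" "adj W * W = 1\<^sub>m m"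
    using assms by (auto simp: unitary_def)
  then show ?thesis
    unfolding unitary_def adj_local_op[OF W(1)]
    by (simp add: local_op_def kron_mult kron_one_one)
qed

lemma conj_mat_index:
  assumes "W \<in> carrier_mat m m" "M \<in> carrier_mat m m" "a < m" "a' < m"
  shows "(W * M * adj W) $$ (a,a') = (\<Sum>e<m. \<Sum>e'<m. W $$ (a,e) * M $$ (e,e') * cnj (W $$ (a',e')))"
proof -
  have "(W * M * adj W) $$ (a,a') = (\<Sum>e'<m. (\<Sum>e<m. W $$ (a,e) * M $$ (e,e')) * cnj (W $$ (a',e')))"
    using assms
    by (subst mult_mat_index[of _ m m _ m])
      (auto simp: mult_mat_index[OF assms(1,2)] simp del: index_mult_mat(1) assoc_mult_mat intro!: sum.cong)
  also have "\<dots> = (\<Sum>e<m. \<Sum>e'<m. W $$ (a,e) * M $$ (e,e') * cnj (W $$ (a',e')))"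
    unfolding sum_distrib_right by (rule sum.swap)
  finally show ?thesis .
qed

lemma local_op_index:
  assumes "a < m" "e < m" "b < k" "f < k"
  shows "local_op m k W $$ (a*k+b, e*k+f) = (if b = f then W $$ (a,e) else 0)"
  using assms by (auto simp: local_op_def kron_index)

text \<open>The identity on the second factor keeps \<open>b\<close> and \<open>b'\<close> fixed, so
  \<open>W\<close> conjugates each block of \<open>X\<close> on its own. \<open>apply_A\<close> is
  defined through the same blocks.\<close>

lemma local_conj_index:
  assumes X: "X \<in> carrier_mat (m*k) (m*k)" and ab: "a < m" "a' < m" "b < k" "b' < k"
  shows "(local_op m k W * X * adj (local_op m k W)) $$ (a*k+b, a'*k+b')
    = (\<Sum>e<m. \<Sum>e'<m. W $$ (a,e) * X $$ (e*k+b, e'*k+b') * cnj (W $$ (a',e')))"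
proof -
  have "(local_op m k W * X * adj (local_op m k W)) $$ (a*k+b, a'*k+b')
    = (\<Sum>e<m. \<Sum>f<k. \<Sum>e'<m. \<Sum>f'<k. (if b = f then W $$ (a,e) else 0) * X $$ (e*k+f, e'*k+f')
         * cnj (if b' = f' then W $$ (a',e') else 0))"
    using ab unfolding conj_mat_index[OF local_op_carrier X bipartite_index_less[OF ab(1,3)] bipartite_index_less[OF ab(2,4)]]
    by (simp add: sum_bipartite local_op_index cong: if_cong)
  also have "\<dots> = (\<Sum>e<m. \<Sum>f<k. if f = b then \<Sum>e'<m. \<Sum>f'<k. W $$ (a,e) * X $$ (e*k+b, e'*k+f')
         * cnj (if b' = f' then W $$ (a',e') else 0) else 0)"
    by (intro sum.cong refl) auto
  also have "\<dots> = (\<Sum>e<m. \<Sum>e'<m. \<Sum>f'<k. W $$ (a,e) * X $$ (e*k+b, e'*k+f')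
         * cnj (if b' = f' then W $$ (a',e') else 0))"
    using ab by simp
  also have "\<dots> = (\<Sum>e<m. \<Sum>e'<m. \<Sum>f'<k. if f' = b' then W $$ (a,e) * X $$ (e*k+b, e'*k+b')
         * cnj (W $$ (a',e')) else 0)"
    by (intro sum.cong refl) auto
  also have "\<dots> = (\<Sum>e<m. \<Sum>e'<m. W $$ (a,e) * X $$ (e*k+b, e'*k+b') * cnj (W $$ (a',e')))"
    using ab by simp
  finally show ?thesis .
qed

lemma apply_A_carrier [simp]: "apply_A m k \<Phi> X \<in> carrier_mat (m*k) (m*k)"
  by (simp add: apply_A_def)

lemma apply_A_index:
  assumes "a < m" "a' < m" "b < k" "b' < k"
  shows "apply_A m k \<Phi> X $$ (a*k+b, a'*k+b') = \<Phi> (mat m m (\<lambda>(e,e'). X $$ (e*k+b, e'*k+b'))) $$ (a,a')"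
  using assms by (simp add: apply_A_def bipartite_index_less)

lemma cptp_carrier: "cptp m \<Phi> \<Longrightarrow> X \<in> carrier_mat m m \<Longrightarrow> \<Phi> X \<in> carrier_mat m m"
  by (simp add: cptp_def)

lemma sandwich_carrier:
  assumes "W \<in> carrier_mat n n" "X \<in> carrier_mat n n"
  shows "W * X * adj W \<in> carrier_mat n n"
  using assms adj_carrier[OF assms(1)] by simp

text \<open>Both sides act block by block on the first factor. An encoder followed by a Weyl unitary
  thus becomes a global conjugation, for which projections and traces are easy to follow.\<close>

lemma apply_A_conj:
  assumes "cptp m \<Phi>" "W \<in> carrier_mat m m"
  shows "apply_A m k (\<lambda>X. W * \<Phi> X * adj W) X = local_op m k W * apply_A m k \<Phi> X * adj (local_op m k W)"
proof (rule bipartite_eqI[of _ m k])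
  fix a a' b b' assume ab: "a < m" "a' < m" "b < k" "b' < k"
  show "apply_A m k (\<lambda>X. W * \<Phi> X * adj W) X $$ (a*k+b, a'*k+b')
     = (local_op m k W * apply_A m k \<Phi> X * adj (local_op m k W)) $$ (a*k+b, a'*k+b')"
    unfolding apply_A_index[OF ab] local_conj_index[OF apply_A_carrier ab]
    by (subst conj_mat_index[OF assms(2) cptp_carrier[OF assms(1)] ab(1,2)]) (auto simp: apply_A_index ab intro!: sum.cong)
qed (auto intro: sandwich_carrier)

lemma mtrace_unitary_conj:
  assumes "unitary n U" "X \<in> carrier_mat n n"
  shows "mtrace (U * X * adj U) = mtrace X"
proof -
  have c: "U \<in> carrier_mat n n" "adj U \<in> carrier_mat n n" "adj U * U = 1\<^sub>m n"
    using assms by (auto simp: unitary_def)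
  have "mtrace (U * (X * adj U)) = mtrace (X * adj U * U)"
    using c assms by (intro mtrace_mult_comm[of _ n n]) auto
  also have "X * adj U * U = X" using c assms by simp
  finally show ?thesis using c assms by simp
qed

lemma psd_unitary_conj:
  assumes "psd n X" "U \<in> carrier_mat n n"
  shows "psd n (U * X * adj U)"
  using psd_conj[OF assms(1) adj_carrier[OF assms(2)]] by simp

text \<open>Complete positivity holds because the extended map is the extension of \<Phi> followed
  by conjugation with a local unitary, which preserves \<open>psd\<close>.\<close>

lemma cptp_unitary_conj:
  assumes \<Phi>: "cptp m \<Phi>" and W: "unitary m W"
  shows "cptp m (\<lambda>X. W * \<Phi> X * adj W)"
proof -
  have c: "W \<in> carrier_mat m m" "adj W \<in> carrier_mat m m" using W by (auto simp: unitary_def)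
  note \<Phi>c = cptp_carrier[OF \<Phi>]
  show ?thesis unfolding cptp_def
  proof (intro conjI ballI allI impI)
    fix X Y :: "complex mat" and z assume X: "X \<in> carrier_mat m m"
    show "W * \<Phi> X * adj W \<in> carrier_mat m m" using c \<Phi>c[OF X] by auto
    show "W * \<Phi> (z \<cdot>\<^sub>m X) * adj W = z \<cdot>\<^sub>m (W * \<Phi> X * adj W)"
      using \<Phi> X c \<Phi>c[OF X] by (simp add: cptp_def mult_smult_distrib[of _ m m _ m] mult_smult_assoc_mat[of _ m m _ m])
    show "mtrace (W * \<Phi> X * adj W) = mtrace X"
      using \<Phi> X mtrace_unitary_conj[OF W \<Phi>c[OF X]] by (simp add: cptp_def)
    assume Y: "Y \<in> carrier_mat m m"
    show "W * \<Phi> (X + Y) * adj W = W * \<Phi> X * adj W + W * \<Phi> Y * adj W"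
      using \<Phi> X Y c \<Phi>c[OF X] \<Phi>c[OF Y]
      by (simp add: cptp_def mult_add_distrib_mat[of _ m m _ m] add_mult_distrib_mat[of _ m m _ _ m] del: assoc_mult_mat)
  next
    fix k X assume "psd (m*k) X"
    then have "psd (m*k) (apply_A m k \<Phi> X)" using \<Phi> by (simp add: cptp_def)
    then show "psd (m*k) (apply_A m k (\<lambda>X. W * \<Phi> X * adj W) X)"
      unfolding apply_A_conj[OF \<Phi> c(1)] by (rule psd_unitary_conj) simp
  qed
qed

lemma cptp_id: "cptp m (\<lambda>X. X)"
proof -
  have "apply_A m k (\<lambda>X. X) X = X" if "X \<in> carrier_mat (m*k) (m*k)" for k X
    using that by (intro bipartite_eqI[of _ m k]) (auto simp: apply_A_index)
  then show ?thesis by (auto simp: cptp_def psd_carrier)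
qed

lemma ptrace_A_carrier [simp]: "ptrace_A m k X \<in> carrier_mat k k"
  by (simp add: ptrace_A_def)

text \<open>Entry (b,b') of the marginal is the trace of the block (b,b'), which a trace-preserving
  map keeps: the sender cannot influence the receiver's state.\<close>

lemma ptrace_A_apply_A:
  assumes "cptp m \<Phi>"
  shows "ptrace_A m k (apply_A m k \<Phi> X) = ptrace_A m k X"
proof (rule eq_matI)
  fix b b' assume "b < dim_row (ptrace_A m k X)" "b' < dim_col (ptrace_A m k X)"
  then have b: "b < k" "b' < k" by (auto simp: ptrace_A_def)
  define M where "M = mat m m (\<lambda>(e,e'). X $$ (e*k+b, e'*k+b'))"
  have M: "M \<in> carrier_mat m m" by (simp add: M_def)
  have "ptrace_A m k (apply_A m k \<Phi> X) $$ (b,b') = (\<Sum>a<m. \<Phi> M $$ (a,a))"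
    using b by (auto simp: ptrace_A_def apply_A_index M_def intro!: sum.cong)
  also have "\<dots> = mtrace (\<Phi> M)" using cptp_carrier[OF assms M] by (auto simp: mtrace_def)
  also have "\<dots> = mtrace M" using assms M by (simp add: cptp_def)
  also have "\<dots> = ptrace_A m k X $$ (b,b')" using b by (auto simp: M_def mtrace_def ptrace_A_def)
  finally show "ptrace_A m k (apply_A m k \<Phi> X) $$ (b,b') = ptrace_A m k X $$ (b,b')" .
qed (auto simp: ptrace_A_def)

lemma mtrace_ptrace_A:
  assumes "X \<in> carrier_mat (m*k) (m*k)"
  shows "mtrace (ptrace_A m k X) = mtrace X"
  using assms by (auto simp: mtrace_def ptrace_A_def sum_bipartite intro: sum.swap)

text \<open>\<open>cptp\<close> speaks of traces on the first factor only; the trace on the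
  bipartite system is recovered through the unchanged marginal.\<close>

lemma density_apply_A:
  assumes "cptp m \<Phi>" "density (m*k) X"
  shows "density (m*k) (apply_A m k \<Phi> X)"
proof -
  have X: "psd (m*k) X" "mtrace X = 1" using assms by (auto simp: density_def)
  have "mtrace (apply_A m k \<Phi> X) = mtrace X"
    using mtrace_ptrace_A[of X m k] mtrace_ptrace_A[of "apply_A m k \<Phi> X" m k] ptrace_A_apply_A[OF assms(1)]
      psd_carrier[OF X(1)] by simp
  then show ?thesis using X assms(1) by (simp add: density_def cptp_def)
qed

subsection \<open>The Weyl twirl\<close>

text \<open>The Heisenberg-Weyl operator X^x Z^q for \<open>p = (x, q)\<close>: the phases Z^q act
  before the cyclic shift X^x.\<close>

definition weyl :: "nat \<Rightarrow> nat \<times> nat \<Rightarrow> complex mat" where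
  "weyl m p = mat m m (\<lambda>(a,e). if a = (e + fst p) mod m
     then exp (2 * of_real pi * \<i> * of_nat e / of_nat m) ^ snd p else 0)"

lemma weyl_carrier [simp]: "weyl m p \<in> carrier_mat m m"
  by (simp add: weyl_def)

text \<open>The natural number \<open>m - x\<close> stands for -x modulo \<open>m\<close>. The
  equivalence serves to solve for the column when the shift is fixed, and for the shift when the
  column is fixed.\<close>

lemma shift_mod_iff:
  assumes "a < m" "e < m" "x < (m::nat)"
  shows "a = (e + x) mod m \<longleftrightarrow> e = (a + (m - x)) mod m"
proof
  assume "a = (e + x) mod m"
  then have "(a + (m - x)) mod m = (e + x + (m - x)) mod m" by (simp add: mod_add_left_eq)
  also have "\<dots> = e" using assms by simp
  finally show "e = (a + (m - x)) mod m" by simp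
next
  assume "e = (a + (m - x)) mod m"
  then have "(e + x) mod m = (a + (m - x) + x) mod m" by (simp add: mod_add_left_eq)
  also have "\<dots> = a" using assms by simp
  finally show "a = (e + x) mod m" by simp
qed

lemma norm_exp_root: "cmod (exp (2 * of_real pi * \<i> * of_nat e / of_nat m)) = 1"
  by (simp add: norm_exp_eq_Re)

lemma weyl_unitary:
  assumes "fst p < m"
  shows "unitary m (weyl m p)"
proof -
  let ?z = "\<lambda>e. exp (2 * of_real pi * \<i> * of_nat e / of_nat m) :: complex"
  have zz: "?z e ^ q * cnj (?z e ^ q) = 1" for e q
    by (simp only: complex_norm_square[symmetric] norm_power norm_exp_root) simp
  have "weyl m p * adj (weyl m p) = 1\<^sub>m m"
  proof (rule eq_matI)
    fix a a' assume "a < dim_row (1\<^sub>m m :: complex mat)" "a' < dim_col (1\<^sub>m m :: complex mat)"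
    then have a: "a < m" "a' < m" by auto
    let ?e = "(a + (m - fst p)) mod m"
    have e: "?e < m" using a by auto
    have "(weyl m p * adj (weyl m p)) $$ (a,a') = (\<Sum>e<m. weyl m p $$ (a,e) * cnj (weyl m p $$ (a',e)))"
      using a by (subst mult_mat_index[of _ m m _ m]) (auto simp: weyl_def intro!: sum.cong)
    also have "\<dots> = (\<Sum>e<m. if e = ?e then (if a = a' then 1 else 0) else 0)"
    proof (rule sum.cong)
      fix e assume "e \<in> {..<m}"
      then have e: "e < m" by simp
      show "weyl m p $$ (a,e) * cnj (weyl m p $$ (a',e)) = (if e = ?e then (if a = a' then 1 else 0) else 0)"
        using shift_mod_iff[OF a(1) e assms] shift_mod_iff[OF a(2) e assms] a e zz[of e "snd p"]
        by (auto simp: weyl_def)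
    qed simp
    also have "\<dots> = 1\<^sub>m m $$ (a,a')" using a e by simp
    finally show "(weyl m p * adj (weyl m p)) $$ (a,a') = 1\<^sub>m m $$ (a,a')" .
  qed (auto simp: weyl_def)
  moreover from this have "adj (weyl m p) * weyl m p = 1\<^sub>m m"
    by (rule mat_mult_left_right_inverse[OF weyl_carrier adj_carrier[OF weyl_carrier]])
  ultimately show ?thesis by (simp add: unitary_def)
qed

text \<open>Orthogonality of the characters of Z/m: the sum is geometric, its ratio is an m-th root
  of unity, and the ratio is 1 only for equal indices.\<close>

lemma root_character_sum:
  assumes "e < m" "e' < m"
  shows "(\<Sum>q<m. exp (2 * of_real pi * \<i> * of_nat e / of_nat m) ^ q
     * cnj (exp (2 * of_real pi * \<i> * of_nat e' / of_nat m) ^ q)) = (if e = e' then of_nat m else 0 :: complex)"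
proof -
  let ?z = "\<lambda>e. exp (2 * of_real pi * \<i> * of_nat e / of_nat m) :: complex"
  let ?w = "?z e * cnj (?z e')"
  have zz: "?z e * cnj (?z e) = 1" for e
    by (simp only: complex_norm_square[symmetric] norm_exp_root) simp
  have zm: "?z e ^ m = 1" for e using complex_root_unity[of m e] assms by simp
  have S: "(\<Sum>q<m. ?z e ^ q * cnj (?z e' ^ q)) = (\<Sum>q<m. ?w ^ q)"
    by (simp only: power_mult_distrib complex_cnj_power)
  show ?thesis
  proof (cases "e = e'")
    case True
    then have "?w = 1" using zz by simp
    then show ?thesis unfolding S using True by simp
  next
    case False
    have "?w \<noteq> 1"
    proof
      assume "?w = 1"
      then have "?w * ?z e' = ?z e'" by simp
      then have "?z e = ?z e'" using zz[of e'] by (metis mult.assoc mult.commute mult.right_neutral)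
      then show False using False complex_root_unity_eq[of m e e'] assms by (auto simp: mod_less)
    qed
    moreover have "?w ^ m = 1"
      by (simp only: power_mult_distrib complex_cnj_power[symmetric] zm) simp
    ultimately show ?thesis unfolding S using False by (simp add: geometric_sum)
  qed
qed

text \<open>The phases force e = e'; the shift conditions then force a = a' and leave exactly one
  shift, so a single factor \<open>m\<close> survives.\<close>

lemma weyl_design:
  assumes "a < m" "a' < m" "e < m" "e' < m"
  shows "(\<Sum>p\<in>{..<m}\<times>{..<m}. weyl m p $$ (a,e) * cnj (weyl m p $$ (a',e')))
    = (if a = a' \<and> e = e' then of_nat m else 0)"
proof -
  let ?z = "\<lambda>e. exp (2 * of_real pi * \<i> * of_nat e / of_nat m) :: complex"
  have "(\<Sum>p\<in>{..<m}\<times>{..<m}. weyl m p $$ (a,e) * cnj (weyl m p $$ (a',e')))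
    = (\<Sum>x<m. \<Sum>q<m. if a = (e + x) mod m \<and> a' = (e' + x) mod m then ?z e ^ q * cnj (?z e' ^ q) else 0)"
    unfolding sum.cartesian_product using assms by (intro sum.cong) (auto simp: weyl_def)
  also have "\<dots> = (\<Sum>x<m. if a = (e + x) mod m \<and> a' = (e' + x) mod m then (\<Sum>q<m. ?z e ^ q * cnj (?z e' ^ q)) else 0)"
    by (intro sum.cong) auto
  also have "\<dots> = (\<Sum>x<m. if a = (e + x) mod m \<and> a' = (e' + x) mod m then (if e = e' then of_nat m else 0) else 0)"
    unfolding root_character_sum[OF assms(3,4)] ..
  also have "\<dots> = (\<Sum>x<m. if x = (a + (m - e)) mod m then (if a = a' \<and> e = e' then of_nat m else 0) else 0)"
  proof (rule sum.cong)
    fix x assume "x \<in> {..<m}"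
    then have x: "x < m" by simp
    show "(if a = (e + x) mod m \<and> a' = (e' + x) mod m then (if e = e' then of_nat m else 0) else 0)
      = (if x = (a + (m - e)) mod m then (if a = a' \<and> e = e' then of_nat m else 0) else (0::complex))"
    proof -
      have h: "x = (a + (m - e)) mod m \<longleftrightarrow> a = (e + x) mod m"
        using shift_mod_iff[OF assms(1) x assms(3)] by (simp only: add.commute[of e x])
      show ?thesis unfolding h by auto
    qed
  qed simp
  also have "\<dots> = (if a = a' \<and> e = e' then of_nat m else 0)" using assms by simp
  finally show ?thesis .
qed

definition weyl_op :: "nat \<Rightarrow> nat \<Rightarrow> nat \<times> nat \<Rightarrow> complex mat" where
  "weyl_op m k p = local_op m k (weyl m p)"

lemma weyl_op_unitary: "fst p < m \<Longrightarrow> unitary (m*k) (weyl_op m k p)"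
  by (simp add: weyl_op_def local_op_unitary weyl_unitary)

lemma weyl_op_carrier [simp]: "weyl_op m k p \<in> carrier_mat (m*k) (m*k)"
  by (simp add: weyl_op_def)

text \<open>By \<open>weyl_design\<close> only the terms with a = a' and e = e' survive, and the sum
  over e is the partial trace. Division by the number m^2 of operators leaves the factor 1/m of the
  average.\<close>

theorem weyl_twirl:
  assumes X: "X \<in> carrier_mat (m*k) (m*k)"
  shows "mat (m*k) (m*k) (\<lambda>(r,c). \<Sum>p\<in>{..<m}\<times>{..<m}. (weyl_op m k p * X * adj (weyl_op m k p)) $$ (r,c))
    = of_nat m \<cdot>\<^sub>m kron m k (1\<^sub>m m) (ptrace_A m k X)"
proof (rule bipartite_eqI[of _ m k])
  fix a a' b b' assume ab: "a < m" "a' < m" "b < k" "b' < k"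
  let ?I = "{..<m}\<times>{..<m}"
  have "(\<Sum>p\<in>?I. (weyl_op m k p * X * adj (weyl_op m k p)) $$ (a*k+b, a'*k+b'))
    = (\<Sum>p\<in>?I. \<Sum>e<m. \<Sum>e'<m. weyl m p $$ (a,e) * X $$ (e*k+b, e'*k+b') * cnj (weyl m p $$ (a',e')))"
    unfolding weyl_op_def local_conj_index[OF X ab] ..
  also have "\<dots> = (\<Sum>e<m. \<Sum>p\<in>?I. \<Sum>e'<m. weyl m p $$ (a,e) * X $$ (e*k+b, e'*k+b') * cnj (weyl m p $$ (a',e')))"
    by (rule sum.swap)
  also have "\<dots> = (\<Sum>e<m. \<Sum>e'<m. \<Sum>p\<in>?I. weyl m p $$ (a,e) * X $$ (e*k+b, e'*k+b') * cnj (weyl m p $$ (a',e')))"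
    by (intro sum.cong refl sum.swap)
  also have "\<dots> = (\<Sum>e<m. \<Sum>e'<m. X $$ (e*k+b, e'*k+b') * (\<Sum>p\<in>?I. weyl m p $$ (a,e) * cnj (weyl m p $$ (a',e'))))"
    unfolding sum_distrib_left by (intro sum.cong refl) (simp add: mult_ac)
  also have "\<dots> = (\<Sum>e<m. \<Sum>e'<m. if e' = e then (if a = a' then of_nat m * X $$ (e*k+b, e*k+b') else 0) else 0)"
    using ab by (intro sum.cong refl) (auto simp: weyl_design)
  also have "\<dots> = (\<Sum>e<m. if a = a' then of_nat m * X $$ (e*k+b, e*k+b') else 0)"
    by (intro sum.cong refl) auto
  also have "\<dots> = (of_nat m \<cdot>\<^sub>m kron m k (1\<^sub>m m) (ptrace_A m k X)) $$ (a*k+b, a'*k+b')"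
    using ab by (simp add: kron_index bipartite_index_less ptrace_A_def sum_distrib_left)
  finally show "mat (m*k) (m*k) (\<lambda>(r,c). \<Sum>p\<in>?I. (weyl_op m k p * X * adj (weyl_op m k p)) $$ (r,c)) $$ (a*k+b, a'*k+b')
     = (of_nat m \<cdot>\<^sub>m kron m k (1\<^sub>m m) (ptrace_A m k X)) $$ (a*k+b, a'*k+b')"
    using ab by (simp add: bipartite_index_less del: index_mult_mat)
qed auto

section \<open>Consequences of the twirl for traces and positivity\<close>

lemma mtrace_mult_sum:
  assumes "P \<in> carrier_mat n n" "\<And>i. i \<in> I \<Longrightarrow> A i \<in> carrier_mat n n"
  shows "mtrace (P * mat n n (\<lambda>(r,c). \<Sum>i\<in>I. A i $$ (r,c))) = (\<Sum>i\<in>I. mtrace (P * A i))"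
proof -
  have "mtrace (P * mat n n (\<lambda>(r,c). \<Sum>i\<in>I. A i $$ (r,c))) = (\<Sum>j<n. \<Sum>l<n. \<Sum>i\<in>I. P $$ (j,l) * A i $$ (l,j))"
    using assms(1) by (subst mtrace_mult[of _ n n]) (auto simp: sum_distrib_left intro!: sum.cong)
  also have "\<dots> = (\<Sum>j<n. \<Sum>i\<in>I. \<Sum>l<n. P $$ (j,l) * A i $$ (l,j))"
    by (intro sum.cong refl sum.swap)
  also have "\<dots> = (\<Sum>i\<in>I. \<Sum>j<n. \<Sum>l<n. P $$ (j,l) * A i $$ (l,j))" by (rule sum.swap)
  also have "\<dots> = (\<Sum>i\<in>I. mtrace (P * A i))"
    using assms by (intro sum.cong refl) (simp add: mtrace_mult[of _ n n])
  finally show ?thesis .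
qed

lemma weyl_twirl_mtrace:
  assumes X: "X \<in> carrier_mat (m*k) (m*k)" and P: "P \<in> carrier_mat (m*k) (m*k)"
  shows "(\<Sum>p\<in>{..<m}\<times>{..<m}. mtrace (P * (weyl_op m k p * X * adj (weyl_op m k p))))
    = of_nat m * mtrace (P * kron m k (1\<^sub>m m) (ptrace_A m k X))"
proof -
  have c: "weyl_op m k p * X * adj (weyl_op m k p) \<in> carrier_mat (m*k) (m*k)" for p
    by (rule sandwich_carrier[OF weyl_op_carrier X])
  have "(\<Sum>p\<in>{..<m}\<times>{..<m}. mtrace (P * (weyl_op m k p * X * adj (weyl_op m k p))))
    = mtrace (P * (of_nat m \<cdot>\<^sub>m kron m k (1\<^sub>m m) (ptrace_A m k X)))"
    unfolding weyl_twirl[OF X, symmetric] by (rule mtrace_mult_sum[OF P c, symmetric])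
  also have "\<dots> = of_nat m * mtrace (P * kron m k (1\<^sub>m m) (ptrace_A m k X))"
    using P by (simp add: mult_smult_distrib[of _ "m*k" "m*k" _ "m*k"] mtrace_smult[of _ "m*k"])
  finally show ?thesis .
qed

text \<open>Up to a positive factor the operator is a twirl, that is, a sum of unitary conjugates of
  a psd matrix.\<close>

lemma psd_kron_one_ptrace:
  assumes "psd (m*k) X" "m \<ge> 1"
  shows "psd (m*k) (kron m k (1\<^sub>m m) (ptrace_A m k X))" (is "psd _ ?K")
proof -
  have "psd (m*k) (of_nat m \<cdot>\<^sub>m ?K)"
    unfolding weyl_twirl[OF psd_carrier[OF assms(1)], symmetric]
    by (intro psd_sum psd_unitary_conj assms(1) weyl_op_carrier)
  then have "psd (m*k) (complex_of_real (1 / real m) \<cdot>\<^sub>m (of_nat m \<cdot>\<^sub>m ?K))" by (rule psd_scale) simp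
  also have "complex_of_real (1 / real m) \<cdot>\<^sub>m (of_nat m \<cdot>\<^sub>m ?K) = ?K"
    using assms(2) by (intro eq_matI) auto
  finally show ?thesis .
qed

lemma mtrace_kron_one_ptrace:
  assumes "X \<in> carrier_mat (m*k) (m*k)"
  shows "mtrace (kron m k (1\<^sub>m m) (ptrace_A m k X)) = of_nat m * mtrace X"
proof -
  have "mtrace (kron m k (1\<^sub>m m) (ptrace_A m k X)) = (\<Sum>a<m. mtrace (ptrace_A m k X))"
    by (simp add: mtrace_def sum_bipartite kron_index ptrace_A_def)
  then show ?thesis using mtrace_ptrace_A[OF assms] by simp
qed

text \<open>Operators on the first factor commute with 1 \<otimes> B. Hence all rotated tests have
  the same trace against the reference operator.\<close>

lemma weyl_op_kron_invariant:
  assumes "fst p < m" "B \<in> carrier_mat k k"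
  shows "adj (weyl_op m k p) * kron m k (1\<^sub>m m) B * weyl_op m k p = kron m k (1\<^sub>m m) B"
proof -
  have W: "weyl m p \<in> carrier_mat m m" "adj (weyl m p) \<in> carrier_mat m m" "adj (weyl m p) * weyl m p = 1\<^sub>m m"
    using weyl_unitary[OF assms(1)] by (auto simp: unitary_def)
  have "local_op m k (adj (weyl m p)) * kron m k (1\<^sub>m m) B = kron m k (adj (weyl m p)) B"
    by (simp only: local_op_def kron_mult[OF W(2) one_carrier_mat one_carrier_mat assms(2)]
        right_mult_one_mat[OF W(2)] left_mult_one_mat[OF assms(2)])
  moreover have "kron m k (adj (weyl m p)) B * local_op m k (weyl m p) = kron m k (1\<^sub>m m) B"
    using W assms(2) by (simp add: local_op_def kron_mult)
  ultimately show ?thesis unfolding weyl_op_def adj_local_op[OF W(1)] by simp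
qed

subsection \<open>Sequential decoding\<close>

text \<open>The real part of the GNS form of \<open>\<rho>\<close>. For psd \<open>\<rho>\<close> it
  is a symmetric positive semidefinite real form, and its value at (1, 1) is the trace.\<close>

definition weighted_inner :: "complex mat \<Rightarrow> complex mat \<Rightarrow> complex mat \<Rightarrow> real" where
  "weighted_inner \<rho> X Y = Re (mtrace (adj X * Y * \<rho>))"

lemma weighted_inner_sym:
  assumes "hermitian n \<rho>" "X \<in> carrier_mat n n" "Y \<in> carrier_mat n n"
  shows "weighted_inner \<rho> X Y = weighted_inner \<rho> Y X"
proof -
  have c: "\<rho> \<in> carrier_mat n n" "adj \<rho> = \<rho>" "adj X \<in> carrier_mat n n" "adj Y \<in> carrier_mat n n"
    using assms by (auto simp: hermitian_def)
  have "cnj (mtrace (adj X * Y * \<rho>)) = mtrace (adj (adj X * Y * \<rho>))"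
    using c assms by (intro mtrace_adj[symmetric, of _ n]) simp
  also have "adj (adj X * Y * \<rho>) = \<rho> * (adj Y * X)"
    using c assms by (simp add: adj_mult[of _ n n _ n])
  also have "mtrace (\<rho> * (adj Y * X)) = mtrace (adj Y * X * \<rho>)"
    using c assms by (intro mtrace_mult_comm[of _ n n]) auto
  finally show ?thesis unfolding weighted_inner_def by (metis complex_cnj(1) cnj.simps(1))
qed

lemma weighted_inner_minus:
  assumes "\<rho> \<in> carrier_mat n n" "X \<in> carrier_mat n n" "Y \<in> carrier_mat n n" "Z \<in> carrier_mat n n"
  shows "weighted_inner \<rho> X (Y - Z) = weighted_inner \<rho> X Y - weighted_inner \<rho> X Z"
proof -
  have c: "adj X \<in> carrier_mat n n" using assms by auto
  have "adj X * (Y - Z) * \<rho> = adj X * Y * \<rho> - adj X * Z * \<rho>"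
    using assms c
    by (simp add: mult_minus_distrib_mat[of _ n n] minus_mult_distrib_mat[of _ n n] del: assoc_mult_mat)
  moreover have "mtrace (adj X * Y * \<rho> - adj X * Z * \<rho>) = mtrace (adj X * Y * \<rho>) - mtrace (adj X * Z * \<rho>)"
    using assms c by (intro mtrace_minus[of _ n]) auto
  ultimately show ?thesis by (simp add: weighted_inner_def)
qed

lemma weighted_inner_nonneg:
  assumes "psd n \<rho>" "X \<in> carrier_mat n n"
  shows "0 \<le> weighted_inner \<rho> X X"
  unfolding weighted_inner_def by (rule psd_mtrace_mult_nonneg[OF assms(1) psd_adj_mult[OF assms(2)]])

lemma weighted_inner_diff_diff:
  assumes "psd n \<rho>" "X \<in> carrier_mat n n" "Y \<in> carrier_mat n n"
  shows "weighted_inner \<rho> (X - Y) (X - Y)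
    = weighted_inner \<rho> X X - 2 * weighted_inner \<rho> X Y + weighted_inner \<rho> Y Y"
proof -
  have h: "hermitian n \<rho>" "\<rho> \<in> carrier_mat n n" using assms by (auto simp: psd_def hermitian_def)
  have c: "X - Y \<in> carrier_mat n n" using assms by (simp add: minus_carrier_mat)
  show ?thesis
    using weighted_inner_minus[OF h(2) c assms(2,3)] weighted_inner_minus[OF h(2) assms(2) assms(2,3)]
      weighted_inner_minus[OF h(2) assms(3) assms(2,3)]
      weighted_inner_sym[OF h(1) c assms(2)] weighted_inner_sym[OF h(1) c assms(3)]
      weighted_inner_sym[OF h(1) assms(2,3)] by simp
qed

text \<open>Nonnegativity of the form at X - Y and at 2X - Y. The latter is written X - (Y - X), so
  that the expansion of a difference is enough.\<close>

lemma weighted_inner_amgm: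
  assumes "psd n \<rho>" "X \<in> carrier_mat n n" "Y \<in> carrier_mat n n"
  shows "2 * weighted_inner \<rho> X Y \<le> weighted_inner \<rho> X X + weighted_inner \<rho> Y Y"
    and "weighted_inner \<rho> X Y \<le> weighted_inner \<rho> X X + weighted_inner \<rho> Y Y / 4"
proof -
  have c: "X - Y \<in> carrier_mat n n" "Y - X \<in> carrier_mat n n" "X - (Y - X) \<in> carrier_mat n n"
    using assms by (auto intro!: minus_carrier_mat)
  have h: "hermitian n \<rho>" "\<rho> \<in> carrier_mat n n" using assms by (auto simp: psd_def hermitian_def)
  show "2 * weighted_inner \<rho> X Y \<le> weighted_inner \<rho> X X + weighted_inner \<rho> Y Y"
    using weighted_inner_nonneg[OF assms(1) c(1)] weighted_inner_diff_diff[OF assms] by simp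
  show "weighted_inner \<rho> X Y \<le> weighted_inner \<rho> X X + weighted_inner \<rho> Y Y / 4"
    using weighted_inner_nonneg[OF assms(1) c(3)] weighted_inner_diff_diff[OF assms(1,2) c(2)]
      weighted_inner_diff_diff[OF assms(1,3,2)] weighted_inner_minus[OF h(2) assms(2,3,2)]
      weighted_inner_sym[OF h(1) assms(2,3)] by simp
qed

primrec seq_prod :: "nat \<Rightarrow> (nat \<Rightarrow> complex mat) \<Rightarrow> nat \<Rightarrow> complex mat" where
  "seq_prod n P 0 = 1\<^sub>m n"
| "seq_prod n P (Suc i) = P i * seq_prod n P i"

lemma seq_prod_cong: "(\<And>j. j < i \<Longrightarrow> P j = Q j) \<Longrightarrow> seq_prod n P i = seq_prod n Q i"
  by (induction i) auto

lemma seq_prod_carrier: "(\<And>j. j < i \<Longrightarrow> P j \<in> carrier_mat n n) \<Longrightarrow> seq_prod n P i \<in> carrier_mat n n"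
  by (induction i) (auto intro!: mult_carrier_mat[of _ n n _ n])

lemma weighted_inner_projector:
  assumes "projector n P" "B \<in> carrier_mat n n" "\<rho> \<in> carrier_mat n n"
  shows "weighted_inner \<rho> (P * B) (P * B) = weighted_inner \<rho> B (P * B)"
    and "weighted_inner \<rho> P (P * B) = weighted_inner \<rho> (1\<^sub>m n) (P * B)"
    and "weighted_inner \<rho> P P = Re (mtrace (P * \<rho>))"
    and "(1\<^sub>m n - P) * B = B - P * B"
proof -
  have c: "P \<in> carrier_mat n n" "adj P = P" "P * P = P" "adj B \<in> carrier_mat n n"
    using assms by (auto simp: projector_def)
  have PP: "P * (P * Y) = P * Y" if "Y \<in> carrier_mat n n" for Y
    using c that assoc_mult_mat[of P n n P n Y n] by simp
  have "adj (P * B) * (P * B) = adj B * (P * (P * B))"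
    using adj_mult[OF c(1) assms(2)] assoc_mult_mat[OF c(4) c(1), of "P * B" n] c(1,2) assms(2) by simp
  then show "weighted_inner \<rho> (P * B) (P * B) = weighted_inner \<rho> B (P * B)"
    using PP[OF assms(2)] by (simp add: weighted_inner_def)
  show "weighted_inner \<rho> P (P * B) = weighted_inner \<rho> (1\<^sub>m n) (P * B)"
    using c PP[OF assms(2)] assms by (simp add: weighted_inner_def del: assoc_mult_mat)
  show "weighted_inner \<rho> P P = Re (mtrace (P * \<rho>))"
    using c by (simp add: weighted_inner_def del: assoc_mult_mat)
  show "(1\<^sub>m n - P) * B = B - P * B"
    using c assms by (simp add: minus_mult_distrib_mat[of _ n n])
qed

text \<open>Gao's union bound. Writing \<open>B\<^sub>j\<close> for the partial products and \<open>C\<^sub>j = 1 - P\<^sub>j\<close>, one has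
  \<open>\<langle>1, B\<^sub>j - B\<^sub>j\<^sub>+\<^sub>1\<rangle> = \<langle>C\<^sub>j, C\<^sub>j B\<^sub>j\<rangle>\<close>, while \<open>\<parallel>C\<^sub>j B\<^sub>j\<parallel>\<^sup>2\<close> telescopes; the AM-GM inequality with
  weight 1/4 makes the bound linear in the error terms.\<close>

theorem seq_prod_union_bound:
  assumes \<rho>: "psd n \<rho>" and P: "\<And>j. j < i \<Longrightarrow> projector n (P j)"
  shows "weighted_inner \<rho> (seq_prod n P i) (seq_prod n P i) \<le> Re (mtrace \<rho>)"
    and "Re (mtrace \<rho>) - weighted_inner \<rho> (seq_prod n P i) (seq_prod n P i)
      \<le> 4 * (\<Sum>j<i. Re (mtrace ((1\<^sub>m n - P j) * \<rho>)))"
proof -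
  let ?f = "weighted_inner \<rho>"
  let ?B = "seq_prod n P"
  have h: "hermitian n \<rho>" "\<rho> \<in> carrier_mat n n" using \<rho> by (auto simp: psd_def hermitian_def)
  have f1: "?f (1\<^sub>m n) (1\<^sub>m n) = Re (mtrace \<rho>)" using h by (simp add: weighted_inner_def)
  have Bc: "?B j \<in> carrier_mat n n" if "j \<le> i" for j
    using P that by (intro seq_prod_carrier) (auto simp: projector_def)
  \<comment> \<open>The telescoped sum of squared norms is kept in closed form, as the difference of
    its endpoints, so each step only adds its own error term.\<close>
  have inv: "?f (?B j) (?B j) \<le> ?f (1\<^sub>m n) (1\<^sub>m n) \<and>
     ?f (1\<^sub>m n) (1\<^sub>m n) - ?f (1\<^sub>m n) (?B j) \<le>
       (\<Sum>l<j. Re (mtrace ((1\<^sub>m n - P l) * \<rho>))) + (?f (1\<^sub>m n) (1\<^sub>m n) - ?f (?B j) (?B j)) / 4"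
    if "j \<le> i" for j
    using that
  proof (induction j)
    case 0
    then show ?case by simp
  next
    case (Suc j)
    have Pj: "projector n (P j)" "projector n (1\<^sub>m n - P j)" using P Suc.prems projector_compl by auto
    have B: "?B j \<in> carrier_mat n n" "P j * ?B j \<in> carrier_mat n n" "1\<^sub>m n - P j \<in> carrier_mat n n"
      using Bc[of j] Bc[of "Suc j"] Suc.prems Pj by (auto simp: projector_def)
    let ?C = "(1\<^sub>m n - P j) * ?B j"
    have C: "?C \<in> carrier_mat n n" using B by simp
    have Ceq: "?C = ?B j - P j * ?B j" by (rule weighted_inner_projector(4)[OF Pj(1) B(1) h(2)])
    have "?f (1\<^sub>m n) (?B j) - ?f (1\<^sub>m n) (P j * ?B j) = ?f (1\<^sub>m n) ?C"
      unfolding Ceq using weighted_inner_minus[OF h(2) one_carrier_mat B(1,2)] by simp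
    also have "\<dots> = ?f (1\<^sub>m n - P j) ?C" using weighted_inner_projector(2)[OF Pj(2) B(1) h(2)] by simp
    also have "\<dots> \<le> ?f (1\<^sub>m n - P j) (1\<^sub>m n - P j) + ?f ?C ?C / 4"
      by (rule weighted_inner_amgm(2)[OF \<rho> B(3) C])
    also have "?f (1\<^sub>m n - P j) (1\<^sub>m n - P j) = Re (mtrace ((1\<^sub>m n - P j) * \<rho>))"
      by (rule weighted_inner_projector(3)[OF Pj(2) B(1) h(2)])
    finally have 1: "?f (1\<^sub>m n) (?B j) - ?f (1\<^sub>m n) (P j * ?B j) \<le> Re (mtrace ((1\<^sub>m n - P j) * \<rho>)) + ?f ?C ?C / 4" .
    have "?f ?C ?C = ?f (?B j) ?C" by (rule weighted_inner_projector(1)[OF Pj(2) B(1) h(2)])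
    also have "\<dots> = ?f (?B j) (?B j) - ?f (?B j) (P j * ?B j)"
      unfolding Ceq by (rule weighted_inner_minus[OF h(2) B(1) B(1,2)])
    also have "?f (?B j) (P j * ?B j) = ?f (P j * ?B j) (P j * ?B j)"
      by (rule weighted_inner_projector(1)[OF Pj(1) B(1) h(2), symmetric])
    finally have 2: "?f ?C ?C = ?f (?B j) (?B j) - ?f (P j * ?B j) (P j * ?B j)" .
    have 3: "0 \<le> ?f ?C ?C" by (rule weighted_inner_nonneg[OF \<rho> C])
    show ?case using Suc.IH Suc.prems 1 2 3 by (auto simp: field_simps)
  qed
  show "?f (?B i) (?B i) \<le> Re (mtrace \<rho>)" using inv[of i] f1 by simp
  \<comment> \<open>The left side of the invariant is at least half the loss of squared norm, while
    a quarter of that loss stands on the right; the remaining quarter gives the factor 4.\<close>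
  have "2 * ?f (1\<^sub>m n) (?B i) \<le> ?f (1\<^sub>m n) (1\<^sub>m n) + ?f (?B i) (?B i)"
    by (rule weighted_inner_amgm(1)[OF \<rho> one_carrier_mat Bc]) simp
  then show "Re (mtrace \<rho>) - ?f (?B i) (?B i) \<le> 4 * (\<Sum>j<i. Re (mtrace ((1\<^sub>m n - P j) * \<rho>)))"
    using conjunct2[OF inv[OF order_refl]] unfolding f1 by argo
qed

text \<open>The measurement operator for the event that \<open>T i\<close> is the first test to
  succeed when the projective tests are run in order.\<close>

definition seq_decoder :: "nat \<Rightarrow> (nat \<Rightarrow> complex mat) \<Rightarrow> nat \<Rightarrow> complex mat" where
  "seq_decoder n T i = adj (seq_prod n (\<lambda>j. 1\<^sub>m n - T j) i) * T i * seq_prod n (\<lambda>j. 1\<^sub>m n - T j) i"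

lemma seq_decoder_psd:
  assumes "\<And>j. projector n (T j)"
  shows "psd n (seq_decoder n T i)"
  unfolding seq_decoder_def using assms
  by (intro psd_conj[OF projector_psd[OF assms]] seq_prod_carrier minus_carrier_mat) (auto simp: projector_def)

text \<open>What is missing from 1 telescopes to \<open>adj A * A\<close> for the product
  \<open>A\<close> of the complementary projections: the outcome in which every test fails.\<close>

lemma seq_decoder_sum:
  assumes "\<And>j. projector n (T j)"
  shows "psd n (1\<^sub>m n - mat n n (\<lambda>(r,c). \<Sum>i<M. seq_decoder n T i $$ (r,c)))"
proof -
  let ?A = "seq_prod n (\<lambda>j. 1\<^sub>m n - T j)"
  have A: "?A i \<in> carrier_mat n n" for i
    using assms by (intro seq_prod_carrier minus_carrier_mat) (auto simp: projector_def)
  have S: "(adj (?A M) * ?A M) $$ (r,c) = 1\<^sub>m n $$ (r,c) - (\<Sum>i<M. seq_decoder n T i $$ (r,c))"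
    if "r < n" "c < n" for r c
  proof (induction M)
    case 0
    then show ?case using that by simp
  next
    case (Suc i)
    have p: "projector n (T i)" "projector n (1\<^sub>m n - T i)" using assms projector_compl by auto
    have c: "T i \<in> carrier_mat n n" "adj (?A i) \<in> carrier_mat n n" "1\<^sub>m n - T i \<in> carrier_mat n n"
      "adj (1\<^sub>m n - T i) = 1\<^sub>m n - T i" "(1\<^sub>m n - T i) * (1\<^sub>m n - T i) = 1\<^sub>m n - T i"
      using p A[of i] by (auto simp: projector_def)
    have "adj (?A (Suc i)) * ?A (Suc i) = adj (?A i) * ((1\<^sub>m n - T i) * ((1\<^sub>m n - T i) * ?A i))"
      using adj_mult[OF c(3) A[of i]] assoc_mult_mat[OF c(2) c(3), of "(1\<^sub>m n - T i) * ?A i" n] c(3,4) A[of i]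
      by simp
    also have "(1\<^sub>m n - T i) * ((1\<^sub>m n - T i) * ?A i) = (1\<^sub>m n - T i) * ?A i"
      using assoc_mult_mat[OF c(3) c(3) A[of i]] c(5) by simp
    also have "\<dots> = ?A i - T i * ?A i"
      using c A[of i] by (simp add: minus_mult_distrib_mat[of _ n n])
    also have "adj (?A i) * (?A i - T i * ?A i) = adj (?A i) * ?A i - seq_decoder n T i"
      using c A[of i] by (simp add: seq_decoder_def mult_minus_distrib_mat[of _ n n _ n])
    finally have "(adj (?A (Suc i)) * ?A (Suc i)) $$ (r,c) = (adj (?A i) * ?A i) $$ (r,c) - seq_decoder n T i $$ (r,c)"
      using that psd_carrier[OF seq_decoder_psd[of n T i, OF assms]] by simp
    then show ?case using Suc.IH by simp
  qed
  have "1\<^sub>m n - mat n n (\<lambda>(r,c). \<Sum>i<M. seq_decoder n T i $$ (r,c)) = adj (?A M) * ?A M"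
    using S A[of M] by (intro eq_matI) (auto simp del: index_mult_mat(1))
  then show ?thesis using psd_adj_mult[OF A[of M]] by simp
qed

text \<open>The success probability is the squared weighted norm of a product of i + 1 projections:
  the complements of the earlier tests, then \<open>T i\<close>. The union bound charges the false
  alarms of the earlier tests and one miss.\<close>

lemma seq_decoder_error:
  assumes T: "\<And>j. projector n (T j)" and \<rho>: "density n \<rho>"
  shows "Re (mtrace (\<rho> * seq_decoder n T i)) \<le> 1"
    and "1 - Re (mtrace (\<rho> * seq_decoder n T i))
      \<le> 4 * ((\<Sum>j<i. Re (mtrace (T j * \<rho>))) + Re (mtrace ((1\<^sub>m n - T i) * \<rho>)))"
proof -
  let ?A = "seq_prod n (\<lambda>j. 1\<^sub>m n - T j) i"
  let ?P = "\<lambda>j. if j < i then 1\<^sub>m n - T j else T i"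
  have psd: "psd n \<rho>" and tr: "Re (mtrace \<rho>) = 1" using \<rho> by (auto simp: density_def)
  have \<rho>c: "\<rho> \<in> carrier_mat n n" using psd psd_carrier by auto
  have Tc: "T j \<in> carrier_mat n n" for j using T by (auto simp: projector_def)
  have A: "?A \<in> carrier_mat n n" "adj ?A \<in> carrier_mat n n"
    using Tc by (auto intro!: seq_prod_carrier minus_carrier_mat)
  have B: "seq_prod n ?P (Suc i) = T i * ?A"
    using seq_prod_cong[of i ?P "\<lambda>j. 1\<^sub>m n - T j" n] by simp
  have P: "projector n (?P j)" for j using T projector_compl by auto
  have "weighted_inner \<rho> (T i * ?A) (T i * ?A) = weighted_inner \<rho> ?A (T i * ?A)"
    by (rule weighted_inner_projector(1)[OF T A(1) \<rho>c])
  also have "\<dots> = Re (mtrace (seq_decoder n T i * \<rho>))"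
    using A Tc[of i] by (simp add: weighted_inner_def seq_decoder_def)
  also have "mtrace (seq_decoder n T i * \<rho>) = mtrace (\<rho> * seq_decoder n T i)"
    using psd_carrier[OF seq_decoder_psd[of n T i, OF T]] \<rho>c by (rule mtrace_mult_comm)
  finally have E: "weighted_inner \<rho> (T i * ?A) (T i * ?A) = Re (mtrace (\<rho> * seq_decoder n T i))" .
  have I: "1\<^sub>m n - (1\<^sub>m n - T j) = T j" for j using Tc[of j] by (intro eq_matI) auto
  have S: "(\<Sum>j<Suc i. Re (mtrace ((1\<^sub>m n - ?P j) * \<rho>)))
     = (\<Sum>j<i. Re (mtrace (T j * \<rho>))) + Re (mtrace ((1\<^sub>m n - T i) * \<rho>))"
    by (simp add: I)
  show "Re (mtrace (\<rho> * seq_decoder n T i)) \<le> 1"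
    using seq_prod_union_bound(1)[OF psd, of "Suc i" ?P] P unfolding B E tr by blast
  show "1 - Re (mtrace (\<rho> * seq_decoder n T i))
      \<le> 4 * ((\<Sum>j<i. Re (mtrace (T j * \<rho>))) + Re (mtrace ((1\<^sub>m n - T i) * \<rho>)))"
    using seq_prod_union_bound(2)[OF psd, of "Suc i" ?P] P unfolding B E S tr by blast
qed

text \<open>If no candidate fitted at step N, summing over all candidates would contradict the
  averages. Only pairs with the older element first are controlled, as decoding in order requires.
  Every \<open>w i\<close> lies in \<open>I\<close>, even beyond N, because the decoder takes a test
  for every index.\<close>

lemma greedy_choice:
  fixes g :: "'a \<Rightarrow> 'a \<Rightarrow> real"
  assumes I: "finite I" "I \<noteq> {}" and g: "\<And>j. j \<in> I \<Longrightarrow> (\<Sum>w\<in>I. g j w) \<le> real (card I) * \<mu>"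
  shows "\<exists>w::nat \<Rightarrow> 'a. (\<forall>i. w i \<in> I) \<and> (\<forall>i<N. (\<Sum>j<i. g (w j) (w i)) \<le> real i * \<mu>)"
proof (induction N)
  case 0
  then show ?case using I by auto
next
  case (Suc N)
  then obtain w :: "nat \<Rightarrow> 'a" where w: "\<And>i. w i \<in> I" "\<And>i. i < N \<Longrightarrow> (\<Sum>j<i. g (w j) (w i)) \<le> real i * \<mu>" by auto
  have "\<exists>p\<in>I. (\<Sum>j<N. g (w j) p) \<le> real N * \<mu>"
  proof (rule ccontr)
    assume "\<not> ?thesis"
    then have "(\<Sum>p\<in>I. real N * \<mu>) < (\<Sum>p\<in>I. \<Sum>j<N. g (w j) p)"
      using I by (intro sum_strict_mono) auto
    also have "\<dots> = (\<Sum>j<N. \<Sum>p\<in>I. g (w j) p)" by (rule sum.swap)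
    also have "\<dots> \<le> (\<Sum>j<N. real (card I) * \<mu>)" using g w by (intro sum_mono) auto
    finally show False by (simp add: mult_ac)
  qed
  then obtain p where p: "p \<in> I" "(\<Sum>j<N. g (w j) p) \<le> real N * \<mu>" by auto
  have "(\<Sum>j<i. g ((w(N := p)) j) ((w(N := p)) i)) \<le> real i * \<mu>" if "i < Suc N" for i
  proof -
    have "(\<Sum>j<i. g ((w(N := p)) j) ((w(N := p)) i)) = (\<Sum>j<i. g (w j) ((w(N := p)) i))"
      using that by (intro sum.cong) auto
    then show ?thesis using that w(2)[of i] p(2) by (cases "i = N") auto
  qed
  then show ?case using w(1) p(1) by (intro exI[of _ "w(N := p)"]) auto
qed

subsection \<open>One-shot bounds\<close>

text \<open>The threshold \<open>t\<close> is free here and becomes e^{-n \<gamma>} only in the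
  asymptotic part, so that the one-shot bounds concern a single pair of systems.\<close>

definition excess_op :: "nat \<Rightarrow> nat \<Rightarrow> complex mat \<Rightarrow> real \<Rightarrow> complex mat" where
  "excess_op m k \<tau> t = \<tau> - complex_of_real t \<cdot>\<^sub>m kron m k (1\<^sub>m m) (ptrace_A m k \<tau>)"

text \<open>For a state and \<open>t \<ge> 0\<close> this is the trace of the positive part of
  \<open>excess_op\<close>.\<close>

definition excess :: "nat \<Rightarrow> nat \<Rightarrow> complex mat \<Rightarrow> real \<Rightarrow> real" where
  "excess m k \<tau> t = Re (mtrace (nonneg_proj (m*k) (excess_op m k \<tau> t) * excess_op m k \<tau> t))"

lemma hermitian_excess_op:
  assumes "psd (m*k) \<tau>" "m \<ge> 1" "0 \<le> t"
  shows "hermitian (m*k) (excess_op m k \<tau> t)"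
proof -
  have "psd (m*k) (complex_of_real t \<cdot>\<^sub>m kron m k (1\<^sub>m m) (ptrace_A m k \<tau>))"
    using psd_scale[OF psd_kron_one_ptrace[OF assms(1,2)] assms(3)] .
  then show ?thesis
    using assms(1) by (auto simp: excess_op_def hermitian_def psd_def adj_minus[of _ "m*k" "m*k"] minus_carrier_mat)
qed

lemma mtrace_mult_excess_op:
  assumes "\<tau> \<in> carrier_mat (m*k) (m*k)" "E \<in> carrier_mat (m*k) (m*k)"
  shows "Re (mtrace (E * excess_op m k \<tau> t))
    = Re (mtrace (E * \<tau>)) - t * Re (mtrace (E * kron m k (1\<^sub>m m) (ptrace_A m k \<tau>)))"
proof -
  let ?K = "kron m k (1\<^sub>m m) (ptrace_A m k \<tau>)"
  have "E * excess_op m k \<tau> t = E * \<tau> - complex_of_real t \<cdot>\<^sub>m (E * ?K)"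
    unfolding excess_op_def using assms
    by (simp add: mult_minus_distrib_mat[of _ "m*k" "m*k" _ "m*k"] mult_smult_distrib[of _ "m*k" "m*k" _ "m*k"])
  moreover have "mtrace (E * \<tau> - complex_of_real t \<cdot>\<^sub>m (E * ?K)) = mtrace (E * \<tau>) - complex_of_real t * mtrace (E * ?K)"
    using assms mtrace_minus[of "E * \<tau>" "m*k" "complex_of_real t \<cdot>\<^sub>m (E * ?K)"] mtrace_smult[of "E * ?K" "m*k"] by simp
  ultimately show ?thesis by simp
qed

lemma projector_mtrace_le:
  assumes "projector n P" "density n \<tau>"
  shows "Re (mtrace ((1\<^sub>m n - P) * \<tau>)) = 1 - Re (mtrace (P * \<tau>))" "Re (mtrace (P * \<tau>)) \<le> 1"
proof -
  have c: "P \<in> carrier_mat n n" "\<tau> \<in> carrier_mat n n" "psd n \<tau>" "mtrace \<tau> = 1"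
    using assms psd_carrier by (auto simp: projector_def density_def)
  show 1: "Re (mtrace ((1\<^sub>m n - P) * \<tau>)) = 1 - Re (mtrace (P * \<tau>))"
    using c by (simp add: minus_mult_distrib_mat[of _ n n] mtrace_minus[of _ n])
  show "Re (mtrace (P * \<tau>)) \<le> 1"
    using psd_mtrace_mult_nonneg[OF c(3) projector_psd[OF projector_compl[OF assms(1)]]] 1 by simp
qed

text \<open>The subtracted trace is nonnegative. This is the upper half of the squeeze that
  identifies lower limit 1 with convergence to 1.\<close>

lemma excess_le_1:
  assumes "density (m*k) \<tau>" "m \<ge> 1" "0 \<le> t"
  shows "excess m k \<tau> t \<le> 1"
proof -
  let ?P = "nonneg_proj (m*k) (excess_op m k \<tau> t)"
  have \<tau>: "psd (m*k) \<tau>" using assms by (simp add: density_def)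
  have P: "projector (m*k) ?P" by (rule nonneg_proj_optimal(1)[OF hermitian_excess_op[OF \<tau> assms(2,3)]])
  have "0 \<le> Re (mtrace (?P * kron m k (1\<^sub>m m) (ptrace_A m k \<tau>)))"
    by (rule psd_mtrace_mult_nonneg[OF psd_kron_one_ptrace[OF \<tau> assms(2)] projector_psd[OF P]])
  then have "0 \<le> t * Re (mtrace (?P * kron m k (1\<^sub>m m) (ptrace_A m k \<tau>)))" using assms(3) by simp
  then show ?thesis
    unfolding excess_def mtrace_mult_excess_op[OF psd_carrier[OF \<tau>] psd_carrier[OF projector_psd[OF P]]]
    using projector_mtrace_le(2)[OF P assms(1)] by linarith
qed

lemma mtrace_weyl_conj:
  assumes P: "P \<in> carrier_mat (m*k) (m*k)" and Y: "Y \<in> carrier_mat (m*k) (m*k)"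
  shows "mtrace (weyl_op m k p * P * adj (weyl_op m k p) * Y) = mtrace (P * (adj (weyl_op m k p) * Y * weyl_op m k p))"
proof -
  let ?V = "weyl_op m k p" and ?n = "m*k"
  have c: "?V \<in> carrier_mat ?n ?n" "adj ?V \<in> carrier_mat ?n ?n" by (auto intro: adj_carrier)
  have "mtrace (?V * (P * (adj ?V * Y))) = mtrace (P * (adj ?V * Y) * ?V)"
    using c P Y by (intro mtrace_mult_comm[of _ ?n ?n] mult_carrier_mat[of _ ?n ?n])
  then show ?thesis using c P Y
    by (simp add: assoc_mult_mat[of _ ?n ?n _ ?n _ ?n] mult_carrier_mat[of _ ?n ?n])
qed

text \<open>The codeword at position i meets i earlier tests, whose total overlap is at most i Tr(P
  K) / m, and its own test, which misses with probability 1 - Tr(P \<tau>). Both are charged to 1 -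
  \<open>excess\<close>; the factor 4 is that of the union bound.\<close>

theorem one_shot_code:
  assumes \<tau>: "density (m*k) \<tau>" and m: "m \<ge> 1" and t: "0 < t"
  shows "\<exists>w Dec. (\<forall>i. fst (w i) < m) \<and> (\<forall>i. psd (m*k) (Dec i)) \<and>
    psd (m*k) (1\<^sub>m (m*k) - mat (m*k) (m*k) (\<lambda>(r,c). \<Sum>i<M. Dec i $$ (r,c))) \<and>
    (\<forall>i<M. let err = 1 - Re (mtrace (weyl_op m k (w i) * \<tau> * adj (weyl_op m k (w i)) * Dec i))
       in 0 \<le> err \<and> err \<le> 4 * (real i / (t * real m) + 1) * (1 - excess m k \<tau> t))"
proof -
  let ?n = "m*k" and ?I = "{..<m}\<times>{..<m}"
  let ?V = "weyl_op m k"
  let ?P = "nonneg_proj ?n (excess_op m k \<tau> t)"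
  let ?K = "kron m k (1\<^sub>m m) (ptrace_A m k \<tau>)"
  let ?v = "excess m k \<tau> t"
  have psd: "psd ?n \<tau>" and tr: "mtrace \<tau> = 1" using \<tau> by (auto simp: density_def)
  have \<tau>c: "\<tau> \<in> carrier_mat ?n ?n" using psd psd_carrier by auto
  have P: "projector ?n ?P"
    using nonneg_proj_optimal(1)[OF hermitian_excess_op[OF psd m]] t by simp
  have Pc: "?P \<in> carrier_mat ?n ?n" using P by (simp add: projector_def)
  have v: "?v = Re (mtrace (?P * \<tau>)) - t * Re (mtrace (?P * ?K))"
    unfolding excess_def by (rule mtrace_mult_excess_op[OF \<tau>c Pc])
  have K0: "0 \<le> Re (mtrace (?P * ?K))"
    by (rule psd_mtrace_mult_nonneg[OF psd_kron_one_ptrace[OF psd m] projector_psd[OF P]])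
  have K1: "t * Re (mtrace (?P * ?K)) \<le> 1 - ?v" using v projector_mtrace_le(2)[OF P \<tau>] by simp
  have P1: "1 - Re (mtrace (?P * \<tau>)) \<le> 1 - ?v" using v K0 t by (simp add: mult_nonneg_nonneg)
  define T where "T p = ?V p * ?P * adj (?V p)" for p
  define \<sigma> where "\<sigma> p = ?V p * \<tau> * adj (?V p)" for p
  have Vc: "?V p \<in> carrier_mat ?n ?n" "adj (?V p) \<in> carrier_mat ?n ?n" for p by (auto intro: adj_carrier)
  have \<sigma>c: "\<sigma> p \<in> carrier_mat ?n ?n" for p unfolding \<sigma>_def by (rule sandwich_carrier[OF Vc(1) \<tau>c])
  have T: "projector ?n (T p)" if "fst p < m" for p
    unfolding T_def by (rule projector_conj[OF P weyl_op_unitary[OF that]])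
  have \<sigma>: "density ?n (\<sigma> p)" if "fst p < m" for p
    unfolding \<sigma>_def density_def
    using psd_unitary_conj[OF psd Vc(1)] mtrace_unitary_conj[OF weyl_op_unitary[OF that] \<tau>c] tr by simp
  have T\<sigma>: "mtrace (T p * \<sigma> p) = mtrace (?P * \<tau>)" if "fst p < m" for p
  proof -
    have "unitary ?n (adj (?V p))" using weyl_op_unitary[OF that, of k] by (auto simp: unitary_def)
    from unitary_conj_cancel[OF this \<tau>c] have "adj (?V p) * \<sigma> p * ?V p = \<tau>" unfolding \<sigma>_def adj_adj .
    then show ?thesis unfolding T_def mtrace_weyl_conj[OF Pc \<sigma>c] by simp
  qed
  have TK: "mtrace (T p * ?K) = mtrace (?P * ?K)" if "fst p < m" for p
    unfolding T_def mtrace_weyl_conj[OF Pc kron_carrier] weyl_op_kron_invariant[OF that ptrace_A_carrier] ..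
  \<comment> \<open>There are m^2 Weyl pairs and the twirl sums to m Tr(P K), so the mean overlap
    keeps one \<open>m\<close> in the denominator.\<close>
  let ?\<mu> = "Re (mtrace (?P * ?K)) / real m"
  have avg: "(\<Sum>w\<in>?I. Re (mtrace (T p * \<sigma> w))) \<le> real (card ?I) * ?\<mu>" if "p \<in> ?I" for p
  proof -
    have p: "fst p < m" using that by auto
    have "(\<Sum>w\<in>?I. Re (mtrace (T p * \<sigma> w))) = Re (\<Sum>w\<in>?I. mtrace (T p * \<sigma> w))" by simp
    also have "(\<Sum>w\<in>?I. mtrace (T p * \<sigma> w)) = of_nat m * mtrace (T p * ?K)"
      unfolding \<sigma>_def using T[OF p] by (intro weyl_twirl_mtrace[OF \<tau>c]) (simp add: projector_def)
    finally show ?thesis using TK[OF p] m by (simp add: field_simps)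
  qed
  have "?I \<noteq> {}" using m by (auto simp: lessThan_empty_iff)
  from greedy_choice[OF _ this, of "\<lambda>p w. Re (mtrace (T p * \<sigma> w))" ?\<mu> M] avg
  obtain w :: "nat \<Rightarrow> nat \<times> nat" where w: "\<And>i. w i \<in> ?I"
    and greedy: "\<And>i. i < M \<Longrightarrow> (\<Sum>j<i. Re (mtrace (T (w j) * \<sigma> (w i)))) \<le> real i * ?\<mu>"
    by auto
  have wm: "fst (w i) < m" for i using w[of i] by auto
  define Tw where "Tw i = T (w i)" for i
  have Tw: "projector ?n (Tw i)" for i unfolding Tw_def by (rule T[OF wm])
  let ?Dec = "seq_decoder ?n Tw"
  have err: "0 \<le> 1 - Re (mtrace (\<sigma> (w i) * ?Dec i)) \<and>
     1 - Re (mtrace (\<sigma> (w i) * ?Dec i)) \<le> 4 * (real i / (t * real m) + 1) * (1 - ?v)" if "i < M" for i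
  proof -
    have "1 - Re (mtrace (\<sigma> (w i) * ?Dec i))
      \<le> 4 * ((\<Sum>j<i. Re (mtrace (Tw j * \<sigma> (w i)))) + Re (mtrace ((1\<^sub>m ?n - Tw i) * \<sigma> (w i))))"
      by (rule seq_decoder_error(2)[OF Tw \<sigma>[OF wm]])
    also have "Re (mtrace ((1\<^sub>m ?n - Tw i) * \<sigma> (w i))) = 1 - Re (mtrace (?P * \<tau>))"
      using projector_mtrace_le(1)[OF Tw[of i] \<sigma>[OF wm[of i]]] T\<sigma>[OF wm[of i]] by (simp add: Tw_def)
    also have "(\<Sum>j<i. Re (mtrace (Tw j * \<sigma> (w i)))) \<le> real i * ?\<mu>" using greedy[OF that] by (simp add: Tw_def)
    \<comment> \<open>Multiplying and dividing by \<open>t\<close> brings in the scaled false alarm,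
      which \<open>K1\<close> bounds.\<close>
    also have "real i * ?\<mu> = (real i / (t * real m)) * (t * Re (mtrace (?P * ?K)))" using t m by simp
    also have "\<dots> \<le> (real i / (t * real m)) * (1 - ?v)" using K1 t by (intro mult_left_mono) auto
    also have "1 - Re (mtrace (?P * \<tau>)) \<le> 1 - ?v" by (rule P1)
    finally have "1 - Re (mtrace (\<sigma> (w i) * ?Dec i)) \<le> 4 * ((real i / (t * real m)) * (1 - ?v) + (1 - ?v))" by simp
    then show ?thesis using seq_decoder_error(1)[of ?n Tw "\<sigma> (w i)" i, OF Tw \<sigma>[OF wm]] by (simp add: algebra_simps)
  qed
  show ?thesis
    by (rule exI[of _ w], rule exI[of _ ?Dec])
      (use wm seq_decoder_psd[of ?n Tw, OF Tw] seq_decoder_sum[of ?n Tw M, OF Tw] err in \<open>auto simp: Let_def \<sigma>_def\<close>)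
qed

text \<open>Each decoder is a competitor of the projection for its own codeword. The reference
  operator K is common to all messages and the decoders sum to at most 1, so the subtracted terms
  cost t Tr K = t m in total, and some message reaches the average.\<close>

theorem one_shot_converse:
  assumes \<rho>: "density (m*k) \<rho>" and m: "m \<ge> 1" and M: "M \<ge> (1::nat)" and t: "0 \<le> t"
    and Enc: "\<And>i. i < M \<Longrightarrow> cptp m (Enc i)"
    and Dec: "\<And>i. i < M \<Longrightarrow> psd (m*k) (Dec i)"
    and Sum: "psd (m*k) (1\<^sub>m (m*k) - mat (m*k) (m*k) (\<lambda>(r,c). \<Sum>i<M. Dec i $$ (r,c)))"
  shows "\<exists>i<M. 1 - (1 / real M) * (\<Sum>i<M. 1 - Re (mtrace (apply_A m k (Enc i) \<rho> * Dec i))) - t * real m / real M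
     \<le> excess m k (apply_A m k (Enc i) \<rho>) t"
proof -
  let ?n = "m*k"
  let ?\<tau> = "\<lambda>i. apply_A m k (Enc i) \<rho>"
  let ?K = "kron m k (1\<^sub>m m) (ptrace_A m k \<rho>)"
  let ?S = "mat ?n ?n (\<lambda>(r,c). \<Sum>i<M. Dec i $$ (r,c))"
  have psd: "psd ?n \<rho>" and tr: "mtrace \<rho> = 1" using \<rho> by (auto simp: density_def)
  have Dc: "Dec i \<in> carrier_mat ?n ?n" if "i < M" for i using Dec[OF that] psd_carrier by auto
  \<comment> \<open>The complement of one decoder is the slack 1 - S plus the other decoders: slot i
    of the sum is filled with the slack, so that \<open>psd_sum\<close> applies.\<close>
  have comp: "psd ?n (1\<^sub>m ?n - Dec i)" if i: "i < M" for i
  proof -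
    have "psd ?n (mat ?n ?n (\<lambda>(r,c). \<Sum>j<M. (if j = i then 1\<^sub>m ?n - ?S else Dec j) $$ (r,c)))"
      using Dec Sum by (intro psd_sum) auto
    also have "mat ?n ?n (\<lambda>(r,c). \<Sum>j<M. (if j = i then 1\<^sub>m ?n - ?S else Dec j) $$ (r,c)) = 1\<^sub>m ?n - Dec i"
    proof (rule eq_matI)
      fix r c assume "r < dim_row (1\<^sub>m ?n - Dec i)" "c < dim_col (1\<^sub>m ?n - Dec i)"
      then have rc: "r < ?n" "c < ?n" using Dc[OF i] by auto
      have "(\<Sum>j<M. (if j = i then 1\<^sub>m ?n - ?S else Dec j) $$ (r,c))
        = (1\<^sub>m ?n - ?S) $$ (r,c) + (\<Sum>j\<in>{..<M}-{i}. Dec j $$ (r,c))"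
        using i by (subst sum.remove[of _ i]) (auto intro!: sum.cong)
      also have "(1\<^sub>m ?n - ?S) $$ (r,c) = 1\<^sub>m ?n $$ (r,c) - (\<Sum>j<M. Dec j $$ (r,c))" using rc by simp
      also have "(\<Sum>j<M. Dec j $$ (r,c)) = Dec i $$ (r,c) + (\<Sum>j\<in>{..<M}-{i}. Dec j $$ (r,c))"
        using i by (subst sum.remove[of _ i]) auto
      finally show "mat ?n ?n (\<lambda>(r,c). \<Sum>j<M. (if j = i then 1\<^sub>m ?n - ?S else Dec j) $$ (r,c)) $$ (r,c)
        = (1\<^sub>m ?n - Dec i) $$ (r,c)"
        using rc Dc[OF i] by simp
    qed (use Dc[OF i] in auto)
    finally show ?thesis .
  qed
  have K: "psd ?n ?K" by (rule psd_kron_one_ptrace[OF psd m])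
  have Sc: "?S \<in> carrier_mat ?n ?n" by simp
  have "0 \<le> Re (mtrace ((1\<^sub>m ?n - ?S) * ?K))" by (rule psd_mtrace_mult_nonneg[OF K Sum])
  also have "(1\<^sub>m ?n - ?S) * ?K = ?K - ?S * ?K"
    by (subst minus_mult_distrib_mat[of _ ?n ?n _ _ ?n]) (auto simp: left_mult_one_mat[OF kron_carrier])
  also have "mtrace (?K - ?S * ?K) = mtrace ?K - mtrace (?S * ?K)"
    using Sc by (intro mtrace_minus[of _ ?n]) auto
  also have "mtrace (?S * ?K) = mtrace (?K * ?S)" using Sc by (intro mtrace_mult_comm[of _ ?n ?n]) auto
  also have "\<dots> = (\<Sum>i<M. mtrace (?K * Dec i))" using Dc by (intro mtrace_mult_sum) auto
  also have "\<dots> = (\<Sum>i<M. mtrace (Dec i * ?K))"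
    using Dc by (intro sum.cong refl mtrace_mult_comm[of _ ?n ?n]) auto
  finally have SK: "(\<Sum>i<M. Re (mtrace (Dec i * ?K))) \<le> real m"
    using mtrace_kron_one_ptrace[OF psd_carrier[OF psd]] tr by simp
  have ex: "Re (mtrace (?\<tau> i * Dec i)) - t * Re (mtrace (Dec i * ?K)) \<le> excess m k (?\<tau> i) t" if i: "i < M" for i
  proof -
    have \<tau>: "psd ?n (?\<tau> i)" using density_apply_A[OF Enc[OF i] \<rho>] by (simp add: density_def)
    have "Re (mtrace (Dec i * excess_op m k (?\<tau> i) t)) \<le> excess m k (?\<tau> i) t"
      unfolding excess_def
      by (rule nonneg_proj_optimal(2)[OF hermitian_excess_op[OF \<tau> m t] Dec[OF i] comp[OF i]])
    then show ?thesis
      unfolding mtrace_mult_excess_op[OF apply_A_carrier Dc[OF i]] ptrace_A_apply_A[OF Enc[OF i]]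
        mtrace_mult_comm[OF Dc[OF i] apply_A_carrier] .
  qed
  let ?b = "1 - (1 / real M) * (\<Sum>i<M. 1 - Re (mtrace (?\<tau> i * Dec i))) - t * real m / real M"
  show ?thesis
  proof (rule ccontr)
    assume "\<not> ?thesis"
    then have "(\<Sum>i<M. excess m k (?\<tau> i) t) < (\<Sum>i<M. ?b)"
      using M by (intro sum_strict_mono) (auto simp: lessThan_empty_iff)
    moreover have "(\<Sum>i<M. Re (mtrace (?\<tau> i * Dec i)) - t * Re (mtrace (Dec i * ?K))) \<le> (\<Sum>i<M. excess m k (?\<tau> i) t)"
      using ex by (intro sum_mono) auto
    moreover have "(\<Sum>i<M. Re (mtrace (?\<tau> i * Dec i)) - t * Re (mtrace (Dec i * ?K)))
      = (\<Sum>i<M. Re (mtrace (?\<tau> i * Dec i))) - t * (\<Sum>i<M. Re (mtrace (Dec i * ?K)))"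
      by (simp add: sum_subtractf sum_distrib_left)
    moreover have "t * (\<Sum>i<M. Re (mtrace (Dec i * ?K))) \<le> t * real m" using SK t by (rule mult_left_mono)
    moreover have "(\<Sum>i<M. ?b) = (\<Sum>i<M. Re (mtrace (?\<tau> i * Dec i))) - t * real m"
      using M by (simp add: sum_subtractf field_simps)
    ultimately show False by linarith
  qed
qed

subsection \<open>The capacity formula\<close>

lemma cond_sup_entropy_rate_excess:
  "cond_sup_entropy_rate mA mB \<tau> =
    Inf (ereal ` {\<gamma>. liminf (\<lambda>n. ereal (excess (mA n) (mB n) (\<tau> n) (exp (- (real n * \<gamma>))))) = 1})"
  by (simp add: cond_sup_entropy_rate_def excess_def excess_op_def Let_def)

lemma real_power_eq_exp: "d \<ge> (1::nat) \<Longrightarrow> real (d^n) = exp (real n * ln (real d))"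
  by (simp add: exp_of_nat_mult)

text \<open>Since M grows at least like e^{nR}, the loss t d^n / M is at most e^{n (ln d - R -
  \<gamma>)}, which the strict inequality on \<gamma> sends to 0.\<close>

lemma dc_achievable_converse:
  assumes d: "d \<ge> 1" and \<rho>: "\<And>n. n \<ge> 1 \<Longrightarrow> density (d^n * dB n) (\<rho> n)"
    and R: "dc_achievable d dB \<rho> R" and \<gamma>: "ln (real d) - R < \<gamma>"
  shows "\<exists>\<Lambda>. (\<forall>n. cptp (d^n) (\<Lambda> n)) \<and>
    liminf (\<lambda>n. ereal (excess (d^n) (dB n) (apply_A (d^n) (dB n) (\<Lambda> n) (\<rho> n)) (exp (- (real n * \<gamma>))))) = 1"
proof -
  obtain M Enc Dec where
    Enc: "\<And>n i. i < M n \<Longrightarrow> cptp (d^n) (Enc n i)" and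
    Dec: "\<And>n i. i < M n \<Longrightarrow> psd (d^n * dB n) (Dec n i)" and
    Sum: "\<And>n. psd (d^n * dB n) (1\<^sub>m (d^n * dB n) - mat (d^n * dB n) (d^n * dB n) (\<lambda>(r,c). \<Sum>i<M n. Dec n i $$ (r,c)))" and
    M: "\<forall>\<^sub>F n in sequentially. exp (real n * R) \<le> real (M n)" and
    err: "(\<lambda>n. (1 / real (M n)) * (\<Sum>i<M n. 1 - Re (mtrace (apply_A (d^n) (dB n) (Enc n i) (\<rho> n) * Dec n i)))) \<longlonglongrightarrow> 0"
    using R unfolding dc_achievable_def by blast
  define Pe where "Pe n = (1 / real (M n)) * (\<Sum>i<M n. 1 - Re (mtrace (apply_A (d^n) (dB n) (Enc n i) (\<rho> n) * Dec n i)))" for n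
  let ?t = "\<lambda>n. exp (- (real n * \<gamma>))"
  let ?ex = "\<lambda>n \<Phi>. excess (d^n) (dB n) (apply_A (d^n) (dB n) \<Phi> (\<rho> n)) (?t n)"
  have dn: "d^n \<ge> 1" for n using d by simp
  \<comment> \<open>States are given from n = 1 on, and a code may be empty for small n. There the
    identity channel fills in, without effect on the limit.\<close>
  have "\<exists>\<Phi>. cptp (d^n) \<Phi> \<and> (n \<ge> 1 \<longrightarrow> M n \<ge> 1 \<longrightarrow> 1 - Pe n - ?t n * real (d^n) / real (M n) \<le> ?ex n \<Phi>)" for n
  proof (cases "n \<ge> 1 \<and> M n \<ge> 1")
    case True
    then obtain i where "i < M n" "1 - Pe n - ?t n * real (d^n) / real (M n) \<le> ?ex n (Enc n i)"
      unfolding Pe_def using one_shot_converse[of "d^n" "dB n" "\<rho> n" "M n" "?t n" "Enc n" "Dec n", OF \<rho> dn _ _ Enc Dec Sum] by auto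
    then show ?thesis using Enc by blast
  next
    case False
    then show ?thesis using cptp_id by blast
  qed
  then obtain \<Lambda> where \<Lambda>: "\<And>n. cptp (d^n) (\<Lambda> n)"
    and low: "\<And>n. n \<ge> 1 \<Longrightarrow> M n \<ge> 1 \<Longrightarrow> 1 - Pe n - ?t n * real (d^n) / real (M n) \<le> ?ex n (\<Lambda> n)"
    by metis
  let ?c = "ln (real d) - R - \<gamma>"
  have "(\<lambda>n. ?ex n (\<Lambda> n)) \<longlonglongrightarrow> 1"
  proof (rule tendsto_sandwich)
    show "\<forall>\<^sub>F n in sequentially. 1 - Pe n - exp ?c ^ n \<le> ?ex n (\<Lambda> n)"
      using M eventually_ge_at_top[of 1]
    proof eventually_elim
      case (elim n)
      have M0: "0 < real (M n)" using elim(1) by (meson exp_gt_zero less_le_trans)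
      have "?t n * real (d^n) / real (M n) \<le> ?t n * real (d^n) / exp (real n * R)"
        by (rule divide_left_mono[OF elim(1) _ mult_pos_pos]) (use M0 in auto)
      also have "\<dots> = exp (real n * ?c)"
        unfolding real_power_eq_exp[OF d] by (simp add: exp_add[symmetric] exp_diff[symmetric] algebra_simps)
      also have "\<dots> = exp ?c ^ n" by (rule exp_of_nat_mult)
      finally show ?case using low[of n] elim(2) M0 by simp
    qed
    show "\<forall>\<^sub>F n in sequentially. ?ex n (\<Lambda> n) \<le> 1"
      using eventually_ge_at_top[of 1]
      by eventually_elim (intro excess_le_1 density_apply_A \<Lambda> \<rho> dn, auto)
    have "(\<lambda>n. exp ?c ^ n) \<longlonglongrightarrow> 0" using \<gamma> by (intro LIMSEQ_realpow_zero) auto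
    then have "(\<lambda>n. 1 - Pe n - exp ?c ^ n) \<longlonglongrightarrow> 1 - 0 - 0"
      using err unfolding Pe_def by (intro tendsto_diff tendsto_const)
    then show "(\<lambda>n. 1 - Pe n - exp ?c ^ n) \<longlonglongrightarrow> 1" by simp
  qed simp
  then have "(\<lambda>n. ereal (?ex n (\<Lambda> n))) \<longlonglongrightarrow> ereal 1" by simp
  from lim_imp_Liminf[OF _ this] have "liminf (\<lambda>n. ereal (?ex n (\<Lambda> n))) = 1" by (simp add: one_ereal_def)
  then show ?thesis using \<Lambda> by blast
qed

text \<open>The error is at most a multiple of 1 - \<open>excess\<close>, which tends to 0 by
  assumption; its decay does not rest on a rate gap, so equality R + \<gamma> = ln d is
  allowed.\<close>

lemma dc_achievable_direct:
  assumes d: "d \<ge> 1" and \<rho>: "\<And>n. n \<ge> 1 \<Longrightarrow> density (d^n * dB n) (\<rho> n)"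
    and \<Lambda>: "\<And>n. cptp (d^n) (\<Lambda> n)"
    and lim: "liminf (\<lambda>n. ereal (excess (d^n) (dB n) (apply_A (d^n) (dB n) (\<Lambda> n) (\<rho> n)) (exp (- (real n * \<gamma>))))) = 1"
    and R: "R + \<gamma> \<le> ln (real d)"
  shows "dc_achievable d dB \<rho> R"
proof -
  let ?t = "\<lambda>n. exp (- (real n * \<gamma>))"
  let ?\<tau> = "\<lambda>n. apply_A (d^n) (dB n) (\<Lambda> n) (\<rho> n)"
  define v where "v n = excess (d^n) (dB n) (?\<tau> n) (?t n)" for n
  have dn: "d^n \<ge> 1" for n using d by simp
  have \<tau>: "density (d^n * dB n) (?\<tau> n)" if "n \<ge> 1" for n using density_apply_A[OF \<Lambda> \<rho>[OF that]] .
  have v1: "v n \<le> 1" if "n \<ge> 1" for n unfolding v_def by (intro excess_le_1 \<tau>[OF that] dn) simp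
  have "limsup (\<lambda>n. ereal (v n)) \<le> 1"
  proof (rule Limsup_bounded)
    show "\<forall>\<^sub>F n in sequentially. ereal (v n) \<le> 1"
      using eventually_ge_at_top[of 1]
    proof eventually_elim
      case (elim n)
      then show ?case using v1[OF elim] by (simp add: one_ereal_def)
    qed
  qed
  moreover have "liminf (\<lambda>n. ereal (v n)) = 1" using lim by (simp add: v_def)
  ultimately have "(\<lambda>n. ereal (v n)) \<longlonglongrightarrow> 1"
    using Liminf_le_Limsup[of sequentially "\<lambda>n. ereal (v n)"] by (intro Liminf_eq_Limsup) auto
  then have vlim: "v \<longlonglongrightarrow> 1" by (simp add: one_ereal_def)
  \<comment> \<open>No state is assumed at n = 0, yet the conditions of \<open>dc_achievable\<close>
    on encoders and decoders range over all n; the empty code meets them there.\<close>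
  define M where "M n = (if n = 0 then 0 else nat \<lceil>exp (real n * R)\<rceil>)" for n
  have ex: "\<exists>w Dec. n \<ge> 1 \<longrightarrow> (\<forall>i. fst (w i) < d^n) \<and> (\<forall>i. psd (d^n * dB n) (Dec i)) \<and>
    psd (d^n * dB n) (1\<^sub>m (d^n * dB n) - mat (d^n * dB n) (d^n * dB n) (\<lambda>(r,c). \<Sum>i<M n. Dec i $$ (r,c))) \<and>
    (\<forall>i<M n. let err = 1 - Re (mtrace (weyl_op (d^n) (dB n) (w i) * ?\<tau> n * adj (weyl_op (d^n) (dB n) (w i)) * Dec i))
       in 0 \<le> err \<and> err \<le> 4 * (real i / (?t n * real (d^n)) + 1) * (1 - v n))" for n
  proof (cases "n \<ge> 1")
    case True
    then show ?thesis using one_shot_code[OF \<tau>[OF True] dn, of "?t n" "M n"] unfolding v_def by auto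
  next
    case False
    then show ?thesis by simp
  qed
  obtain w Dec where wD: "\<And>n. n \<ge> 1 \<longrightarrow> (\<forall>i. fst (w n i) < d^n) \<and> (\<forall>i. psd (d^n * dB n) (Dec n i)) \<and>
    psd (d^n * dB n) (1\<^sub>m (d^n * dB n) - mat (d^n * dB n) (d^n * dB n) (\<lambda>(r,c). \<Sum>i<M n. Dec n i $$ (r,c))) \<and>
    (\<forall>i<M n. let err = 1 - Re (mtrace (weyl_op (d^n) (dB n) (w n i) * ?\<tau> n * adj (weyl_op (d^n) (dB n) (w n i)) * Dec n i))
       in 0 \<le> err \<and> err \<le> 4 * (real i / (?t n * real (d^n)) + 1) * (1 - v n))"
    using ex by metis
  define Enc where "Enc n i X = weyl (d^n) (w n i) * \<Lambda> n X * adj (weyl (d^n) (w n i))" for n i X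
  have app: "apply_A (d^n) (dB n) (Enc n i) (\<rho> n)
     = weyl_op (d^n) (dB n) (w n i) * ?\<tau> n * adj (weyl_op (d^n) (dB n) (w n i))" for n i
    unfolding weyl_op_def Enc_def[abs_def] by (rule apply_A_conj[OF \<Lambda> weyl_carrier])
  define e where "e n i = 1 - Re (mtrace (apply_A (d^n) (dB n) (Enc n i) (\<rho> n) * Dec n i))" for n i
  have e: "0 \<le> e n i" "e n i \<le> 8 * (1 - v n)" if n: "n \<ge> 1" and i: "i < M n" for n i
  proof -
    have *: "0 \<le> e n i \<and> e n i \<le> 4 * (real i / (?t n * real (d^n)) + 1) * (1 - v n)"
      using wD[of n] n i unfolding e_def app Let_def by blast
    then show "0 \<le> e n i" by simp
    \<comment> \<open>An index below a ceiling is below the number itself, so rounding the code size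
      up costs nothing: the ratio stays at most 1, and 4 (1 + 1) = 8.\<close>
    have "int i < \<lceil>exp (real n * R)\<rceil>" using i n by (simp add: M_def)
    then have "real i \<le> exp (real n * R)" by (simp add: less_ceiling_iff)
    then have "real i / (?t n * real (d^n)) \<le> exp (real n * R) / (?t n * real (d^n))"
      using d by (intro divide_right_mono) auto
    also have "\<dots> = exp (real n * (R + \<gamma> - ln (real d)))"
      unfolding real_power_eq_exp[OF d] by (simp add: exp_add[symmetric] exp_diff[symmetric] algebra_simps)
    also have "\<dots> \<le> 1" using R by (simp add: mult_nonneg_nonpos)
    finally have "4 * (real i / (?t n * real (d^n)) + 1) * (1 - v n) \<le> 8 * (1 - v n)"
      using v1[OF n] by (intro mult_right_mono) auto
    then show "e n i \<le> 8 * (1 - v n)" using * by linarith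
  qed
  have lim0: "(\<lambda>n. (1 / real (M n)) * (\<Sum>i<M n. e n i)) \<longlonglongrightarrow> 0"
  proof (rule tendsto_sandwich)
    show "\<forall>\<^sub>F n in sequentially. 0 \<le> (1 / real (M n)) * (\<Sum>i<M n. e n i)"
      using eventually_ge_at_top[of 1]
      by eventually_elim (auto intro!: divide_nonneg_nonneg sum_nonneg e)
    show "\<forall>\<^sub>F n in sequentially. (1 / real (M n)) * (\<Sum>i<M n. e n i) \<le> 8 * (1 - v n)"
      using eventually_ge_at_top[of 1]
    proof eventually_elim
      case (elim n)
      have "(1 / real (M n)) * (\<Sum>i<M n. e n i) \<le> (1 / real (M n)) * (\<Sum>i<M n. 8 * (1 - v n))"
        using e elim by (intro mult_left_mono sum_mono) auto
      also have "\<dots> \<le> 8 * (1 - v n)" using v1[OF elim] by (cases "M n = 0") auto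
      finally show ?case .
    qed
    have "(\<lambda>n. 8 * (1 - v n)) \<longlonglongrightarrow> 8 * (1 - 1)" by (intro tendsto_intros vlim)
    then show "(\<lambda>n. 8 * (1 - v n)) \<longlonglongrightarrow> 0" by simp
  qed simp
  have Mge: "\<forall>\<^sub>F n in sequentially. exp (real n * R) \<le> real (M n)"
    using eventually_ge_at_top[of 1] by eventually_elim (simp add: M_def of_nat_ceiling)
  have encc: "cptp (d^n) (Enc n i)" if "i < M n" for n i
  proof -
    have "n \<ge> 1" using that by (cases n) (auto simp: M_def)
    then have "fst (w n i) < d^n" using wD[of n] by blast
    then show ?thesis unfolding Enc_def[abs_def] by (intro cptp_unitary_conj \<Lambda> weyl_unitary)
  qed
  have dec: "psd (d^n * dB n) (Dec n i)" if "i < M n" for n i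
  proof -
    have "n \<ge> 1" using that by (cases n) (auto simp: M_def)
    then show ?thesis using wD[of n] by blast
  qed
  have sum: "psd (d^n * dB n) (1\<^sub>m (d^n * dB n) - mat (d^n * dB n) (d^n * dB n) (\<lambda>(r,c). \<Sum>i<M n. Dec n i $$ (r,c)))" for n
  proof (cases "n \<ge> 1")
    case True
    then show ?thesis using wD[of n] by blast
  next
    case False
    then have "1\<^sub>m (d^n * dB n) - mat (d^n * dB n) (d^n * dB n) (\<lambda>(r,c). \<Sum>i<M n. Dec n i $$ (r,c)) = 1\<^sub>m (d^n * dB n)"
      by (intro eq_matI) (auto simp: M_def)
    then show ?thesis using psd_one by simp
  qed
  show ?thesis unfolding dc_achievable_def
    by (rule exI[of _ M], rule exI[of _ Enc], rule exI[of _ Dec])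
      (use encc dec sum Mge lim0 in \<open>unfold e_def, blast\<close>)
qed

theorem theorem4:
  fixes d :: nat and dB :: "nat \<Rightarrow> nat" and \<rho> :: "nat \<Rightarrow> complex mat"
  assumes "d \<ge> 1"
    and "\<And>n. n \<ge> 1 \<Longrightarrow> density (d^n * dB n) (\<rho> n)"
  shows "dc_capacity d dB \<rho> =
    ereal (ln (real d)) -
      (INF \<Lambda> \<in> {\<Lambda> :: nat \<Rightarrow> complex mat \<Rightarrow> complex mat. \<forall>n. cptp (d^n) (\<Lambda> n)}.
         cond_sup_entropy_rate (\<lambda>n. d^n) dB (\<lambda>n. apply_A (d^n) (dB n) (\<Lambda> n) (\<rho> n)))"
proof (rule antisym)
  let ?L = "ln (real d)"
  let ?C = "{\<Lambda> :: nat \<Rightarrow> complex mat \<Rightarrow> complex mat. \<forall>n. cptp (d^n) (\<Lambda> n)}"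
  let ?S = "\<lambda>\<Lambda>. cond_sup_entropy_rate (\<lambda>n. d^n) dB (\<lambda>n. apply_A (d^n) (dB n) (\<Lambda> n) (\<rho> n))"
  let ?I = "INF \<Lambda> \<in> ?C. ?S \<Lambda>"
  let ?lim = "\<lambda>\<Lambda> \<gamma>. liminf (\<lambda>n. ereal (excess (d^n) (dB n) (apply_A (d^n) (dB n) (\<Lambda> n) (\<rho> n)) (exp (- (real n * \<gamma>))))) = 1"
  show "dc_capacity d dB \<rho> \<le> ereal ?L - ?I"
    unfolding dc_capacity_def
  proof (rule SUP_least)
    fix R assume "R \<in> {R. dc_achievable d dB \<rho> R}"
    then have R: "dc_achievable d dB \<rho> R" by simp
    \<comment> \<open>The converse asks for a strict gap, so the bound is obtained for every larger
      \<gamma> and carried to ln d - R by density.\<close>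
    have "?I \<le> ereal \<gamma>" if \<gamma>: "?L - R < \<gamma>" for \<gamma>
    proof -
      obtain \<Lambda> where \<Lambda>: "\<forall>n. cptp (d^n) (\<Lambda> n)" "?lim \<Lambda> \<gamma>"
        using dc_achievable_converse[OF assms R \<gamma>] by blast
      have "?S \<Lambda> \<le> ereal \<gamma>" unfolding cond_sup_entropy_rate_excess using \<Lambda>(2) by (intro Inf_lower) auto
      then show ?thesis using \<Lambda>(1) by (intro INF_lower2[of \<Lambda>]) auto
    qed
    note le = this
    have "?I \<le> ereal (?L - R)"
    proof (rule ccontr)
      assume "\<not> ?thesis"
      then have "ereal (?L - R) < ?I" by (simp only: not_le)
      from ereal_dense2[OF this] obtain \<gamma> where "ereal (?L - R) < ereal \<gamma>" "ereal \<gamma> < ?I" by blast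
      then show False using le[of \<gamma>] by (simp only: less_ereal.simps(1) leD)
    qed
    then show "ereal R \<le> ereal ?L - ?I" by (cases ?I) auto
  qed
  show "ereal ?L - ?I \<le> dc_capacity d dB \<rho>"
  proof (rule ccontr)
    assume "\<not> ?thesis"
    then have "dc_capacity d dB \<rho> < ereal ?L - ?I" by (simp only: not_le)
    \<comment> \<open>Capacity and infimum may be infinite; a real \<open>r\<close> strictly between
      the two sides is a rate to which the direct part applies.\<close>
    from ereal_dense2[OF this] obtain r where r: "dc_capacity d dB \<rho> < ereal r" "ereal r < ereal ?L - ?I" by blast
    then have "?I < ereal (?L - r)" by (cases ?I) auto
    then obtain \<Lambda> where \<Lambda>: "\<forall>n. cptp (d^n) (\<Lambda> n)" "?S \<Lambda> < ereal (?L - r)" by (auto simp: INF_less_iff)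
    then obtain \<gamma> where \<gamma>: "?lim \<Lambda> \<gamma>" "\<gamma> < ?L - r"
      unfolding cond_sup_entropy_rate_excess by (auto simp: Inf_less_iff)
    have "dc_achievable d dB \<rho> r"
      using dc_achievable_direct[OF assms, of \<Lambda> \<gamma> r] \<Lambda>(1) \<gamma> by auto
    then have "ereal r \<le> dc_capacity d dB \<rho>" unfolding dc_capacity_def by (intro SUP_upper) simp
    then show False using r(1) by simp
  qed
qed

end
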